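(* For any $\varepsilon_0>0$, $$\sup_{\varepsilon\in(0,\varepsilon_0]}\ \sup_{x\in\mathbb R^d_\varepsilon}\left|\mathbf u^\varepsilon(x,t)-\frac{1}{t^{d/\ell}}H\!\left(\frac{x}{t^{1/\ell}}\right)\right|=O\!\left(\frac{1}{t^{(M+d)/\ell}}\right)\quad\text{as }t\to\infty.$$
   Context: Differential operator. Let $d\in\mathbb N$ and let $\ell\in\mathbb N$ be even. Let $\mathcal A(\mathcal D)=\sum_{|\alpha|=\ell}b_\alpha\mathcal D^\alpha$ with $b_\alpha\in\mathbb C$, $\mathcal D_j=-i\,\partial/\partial y_j$, be a differential operator on $\mathbb R^d$ with symbol $\mathcal A(\xi)=\sum_{|\alpha|=\ell}b_\alpha\xi^\alpha$. It is strongly elliptic: there is $c>0$ with $\operatorname{Re}\mathcal A(\xi)\ge c|\xi|^\ell$ for all $\xi\in\mathbb R^d$. Put $H(y)=\frac{1}{(2\pi)^d}\int_{\mathbb R^d}e^{-\mathcal A(\xi)}e^{iy\xi}\,d\xi$. Difference operator. For $\varepsilon>0$ let $\mathbb R^d_\varepsilon=\varepsilon\mathbb Z^d$. For a function $u$ on $\mathbb R^d$ or on $\mathbb R^d_\varepsilon$ let $\delta_{\varepsilon,k\pm}u(y)=u(y\pm\varepsilon e_k)-u(y)$, where $e_k$ is the $k$th unit coordinate vector. Fix an integer $\hat\ell\ge\ell$ and coefficients $a_\nu\in\mathbb C$ (not depending on $\varepsilon$), $\nu=(\nu_1,\dots,\nu_{2d})$ a multi-index, and let $$\mathbf A_\varepsilon=\varepsilon^{-\ell}\sum_{\ell\le|\nu|\le\hat\ell}a_\nu\,\delta_{\varepsilon,1-}^{\nu_1}\delta_{\varepsilon,1+}^{\nu_2}\cdots\delta_{\varepsilon,d-}^{\nu_{2d-1}}\delta_{\varepsilon,d+}^{\nu_{2d}}.$$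 A function on $\mathbb R^d$ is called smooth if it is continuous and bounded together with all its derivatives. Assume that $\mathbf A_\varepsilon$ is an $M$th order approximation of $\mathcal A(\mathcal D)$ for a fixed $M\in\mathbb N$: for every smooth $u$ there is $C(u)>0$ such that $\sup_{y\in\mathbb R^d}|\mathbf A_\varepsilon u(y)-\mathcal A(\mathcal D)u(y)|\le C(u)\varepsilon^M$ for all $\varepsilon>0$. The symbol of $\mathbf A_\varepsilon$ is $$A(\theta)=\sum_{\ell\le|\nu|\le\hat\ell}a_\nu(e^{-i\theta_1}-1)^{\nu_1}(e^{i\theta_1}-1)^{\nu_2}\cdots(e^{-i\theta_d}-1)^{\nu_{2d-1}}(e^{i\theta_d}-1)^{\nu_{2d}}.$$ Assume $\operatorname{Re}A(\theta)>0$ for all $\theta\in R_\pi\setminus\{0\}$, where $R_\lambda=[-\lambda,\lambda]^d$. First discrete Green function. $\mathbf u^\varepsilon(x,t)$, $x\in\mathbb R^d_\varepsilon$, $t\ge0$, is the function that is rapidly decreasing in $x$ (faster than any negative power of $|x|$), $C^1$ in $t\in[0,\infty)$, and satisfies $\partial_t\mathbf u^\varepsilon+\mathbf A_\varepsilon\mathbf u^\varepsilon=0$ for $t>0$, with $\mathbf u^\varepsilon(0,0)=\varepsilon^{-d}$ and $\mathbf u^\varepsilon(x,0)=0$ for $x\ne0$. It is given by $\mathbf u^\varepsilon(x,t)=\frac1{(2\pi)^d}\int_{R_{\pi/\varepsilon}}e^{-t\varepsilon^{-\ell}A(\varepsilon\eta)}e^{ix\eta}\,d\eta$. *)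

theory Defs
  imports "HOL-Analysis.Analysis"
begin

text \<open>
  Functions live on \<^typ>\<open>real ^ 'd\<close>. The index type carries a linear order so that products of
  operators over the coordinates can be written in a definite order; every dimension
  \<open>d \<ge> 1\<close> is the cardinality of such a type.
\<close>

definition mi_size :: "('j::finite \<Rightarrow> nat) \<Rightarrow> nat" where
  "mi_size \<alpha> = (\<Sum>j\<in>UNIV. \<alpha> j)"

lemma finite_mi_size_le: "finite {\<alpha> :: 'j::finite \<Rightarrow> nat. mi_size \<alpha> \<le> n}"
proof (rule finite_subset)
  show "{\<alpha> :: 'j \<Rightarrow> nat. mi_size \<alpha> \<le> n} \<subseteq> UNIV \<rightarrow>\<^sub>E {..n}"
  proof
    fix \<alpha> :: "'j \<Rightarrow> nat" assume "\<alpha> \<in> {\<alpha>. mi_size \<alpha> \<le> n}"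
    moreover have "\<alpha> j \<le> mi_size \<alpha>" for j
      unfolding mi_size_def by (rule member_le_sum) auto
    ultimately show "\<alpha> \<in> UNIV \<rightarrow>\<^sub>E {..n}"
      using order_trans by (fastforce simp: PiE_UNIV_domain)
  qed
  show "finite ((UNIV :: 'j set) \<rightarrow>\<^sub>E {..n})"
    by (rule finite_PiE) auto
qed

text \<open>\<open>ordered_comp T u = T 1 (T 2 (\<dots> (T d u)))\<close>, the coordinates being taken in increasing order.\<close>

definition ordered_comp :: "('d::{finite,linorder} \<Rightarrow> 'f \<Rightarrow> 'f) \<Rightarrow> 'f \<Rightarrow> 'f" where
  "ordered_comp T u = foldr T (sorted_list_of_set UNIV) u"


section \<open>The differential operator\<close>

definition partial_deriv ::
    "'d::finite \<Rightarrow> (real ^ 'd \<Rightarrow> complex) \<Rightarrow> real ^ 'd \<Rightarrow> complex" where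
  "partial_deriv k u = (\<lambda>y. vector_derivative (\<lambda>s. u (y + s *\<^sub>R axis k 1)) (at 0))"

text \<open>
  All iterated partial derivatives (along arbitrary finite sequences of coordinates, the empty
  sequence giving the function itself) exist, are continuous, and are bounded. The
  differentiability clause is needed because \<^const>\<open>vector_derivative\<close> is total.
\<close>

definition bounded_smooth :: "(real ^ 'd::finite \<Rightarrow> complex) \<Rightarrow> bool" where
  "bounded_smooth u \<longleftrightarrow>
     (\<forall>ks. let v = foldr partial_deriv ks u in
        continuous_on UNIV v \<and> bounded (range v) \<and>
        (\<forall>k y. (\<lambda>s. v (y + s *\<^sub>R axis k 1)) differentiable (at 0)))"

definition D_op :: "'d::finite \<Rightarrow> (real ^ 'd \<Rightarrow> complex) \<Rightarrow> real ^ 'd \<Rightarrow> complex" where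
  "D_op k u = (\<lambda>y. - \<i> * partial_deriv k u y)"

definition D_multi ::
    "('d::{finite,linorder} \<Rightarrow> nat) \<Rightarrow> ((real, 'd) vec \<Rightarrow> complex) \<Rightarrow> (real, 'd) vec \<Rightarrow> complex" where
  "D_multi \<alpha> = ordered_comp (\<lambda>k. D_op k ^^ \<alpha> k)"

definition diff_op ::
    "nat \<Rightarrow> (('d::{finite,linorder} \<Rightarrow> nat) \<Rightarrow> complex) \<Rightarrow>
     ((real, 'd) vec \<Rightarrow> complex) \<Rightarrow> (real, 'd) vec \<Rightarrow> complex" where
  "diff_op l b u = (\<lambda>y. \<Sum>\<alpha> | mi_size \<alpha> = l. b \<alpha> * D_multi \<alpha> u y)"

definition diff_symbol ::
    "nat \<Rightarrow> (('d::finite \<Rightarrow> nat) \<Rightarrow> complex) \<Rightarrow> real ^ 'd \<Rightarrow> complex" where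
  "diff_symbol l b \<xi> = (\<Sum>\<alpha> | mi_size \<alpha> = l. b \<alpha> * (\<Prod>k\<in>UNIV. complex_of_real (\<xi> $ k) ^ \<alpha> k))"

definition strongly_elliptic :: "nat \<Rightarrow> (('d::finite \<Rightarrow> nat) \<Rightarrow> complex) \<Rightarrow> bool" where
  "strongly_elliptic l b \<longleftrightarrow> (\<exists>c>0. \<forall>\<xi>. Re (diff_symbol l b \<xi>) \<ge> c * norm \<xi> ^ l)"

definition heat_profile ::
    "nat \<Rightarrow> (('d::finite \<Rightarrow> nat) \<Rightarrow> complex) \<Rightarrow> real ^ 'd \<Rightarrow> complex" where
  "heat_profile l b y =
     1 / (2 * of_real pi) ^ CARD('d) *
     (LINT \<xi>|lborel. exp (- diff_symbol l b \<xi>) * exp (\<i> * of_real (y \<bullet> \<xi>)))"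


section \<open>The difference operator\<close>

definition grid :: "real \<Rightarrow> (real ^ 'd::finite) set" where
  "grid \<epsilon> = {x. \<forall>k. \<exists>m::int. x $ k = \<epsilon> * of_int m}"

text \<open>
  A multi-index \<open>\<nu> = (\<nu>\<^sub>1, \<dots>, \<nu>\<^sub>2\<^sub>d)\<close> is a function on \<open>'d + 'd\<close>: \<open>\<nu> (Inl k)\<close> is the exponent of
  \<open>\<delta>\<^sub>k\<^sub>-\<close>, i.e. the entry with number \<open>2k - 1\<close>, and \<open>\<nu> (Inr k)\<close> that of \<open>\<delta>\<^sub>k\<^sub>+\<close>, the entry with
  number \<open>2k\<close>.
\<close>

definition delta_minus ::
    "real \<Rightarrow> 'd::finite \<Rightarrow> (real ^ 'd \<Rightarrow> complex) \<Rightarrow> real ^ 'd \<Rightarrow> complex" where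
  "delta_minus \<epsilon> k u = (\<lambda>y. u (y - \<epsilon> *\<^sub>R axis k 1) - u y)"

definition delta_plus ::
    "real \<Rightarrow> 'd::finite \<Rightarrow> (real ^ 'd \<Rightarrow> complex) \<Rightarrow> real ^ 'd \<Rightarrow> complex" where
  "delta_plus \<epsilon> k u = (\<lambda>y. u (y + \<epsilon> *\<^sub>R axis k 1) - u y)"

definition delta_multi ::
    "real \<Rightarrow> ('d::{finite,linorder} + 'd \<Rightarrow> nat) \<Rightarrow>
     ((real, 'd) vec \<Rightarrow> complex) \<Rightarrow> (real, 'd) vec \<Rightarrow> complex" where
  "delta_multi \<epsilon> \<nu> =
     ordered_comp (\<lambda>k. (delta_minus \<epsilon> k ^^ \<nu> (Inl k)) \<circ> (delta_plus \<epsilon> k ^^ \<nu> (Inr k)))"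

text \<open>
  The values of \<open>difference_op l L a \<epsilon> u\<close> on \<^term>\<open>grid \<epsilon>\<close> depend only on those of \<open>u\<close> there,
  so the same definition serves functions on the whole space and on the grid.
\<close>

definition difference_op ::
    "nat \<Rightarrow> nat \<Rightarrow> (('d::{finite,linorder} + 'd \<Rightarrow> nat) \<Rightarrow> complex) \<Rightarrow> real \<Rightarrow>
     ((real, 'd) vec \<Rightarrow> complex) \<Rightarrow> (real, 'd) vec \<Rightarrow> complex" where
  "difference_op l L a \<epsilon> u = (\<lambda>y.
     1 / of_real \<epsilon> ^ l * (\<Sum>\<nu> | l \<le> mi_size \<nu> \<and> mi_size \<nu> \<le> L. a \<nu> * delta_multi \<epsilon> \<nu> u y))"

definition difference_symbol ::
    "nat \<Rightarrow> nat \<Rightarrow> (('d::finite + 'd \<Rightarrow> nat) \<Rightarrow> complex) \<Rightarrow> real ^ 'd \<Rightarrow> complex" where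
  "difference_symbol l L a \<theta> =
     (\<Sum>\<nu> | l \<le> mi_size \<nu> \<and> mi_size \<nu> \<le> L.
        a \<nu> * (\<Prod>k\<in>UNIV. (exp (- \<i> * of_real (\<theta> $ k)) - 1) ^ \<nu> (Inl k)
                        * (exp (\<i> * of_real (\<theta> $ k)) - 1) ^ \<nu> (Inr k)))"

definition approximates_to_order ::
    "nat \<Rightarrow> nat \<Rightarrow> nat \<Rightarrow> (('d::{finite,linorder} + 'd \<Rightarrow> nat) \<Rightarrow> complex) \<Rightarrow>
     (('d \<Rightarrow> nat) \<Rightarrow> complex) \<Rightarrow> bool" where
  "approximates_to_order M l L a b \<longleftrightarrow>
     (\<forall>u. bounded_smooth u \<longrightarrow>
        (\<exists>C>0. \<forall>\<epsilon>>0. \<forall>y. norm (difference_op l L a \<epsilon> u y - diff_op l b u y) \<le> C * \<epsilon> ^ M))"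


section \<open>The first discrete Green function\<close>

text \<open>
  The Cauchy problem that determines \<open>u\<close> on \<open>grid \<epsilon> \<times> [0, \<infinity>)\<close>. At \<open>t = 0\<close> the derivative is
  one-sided.
\<close>

definition discrete_green ::
    "nat \<Rightarrow> nat \<Rightarrow> (('d::{finite,linorder} + 'd \<Rightarrow> nat) \<Rightarrow> complex) \<Rightarrow> real \<Rightarrow>
     ((real, 'd) vec \<Rightarrow> real \<Rightarrow> complex) \<Rightarrow> bool" where
  "discrete_green l L a \<epsilon> u \<longleftrightarrow>
     (\<forall>t\<ge>0. \<forall>n::nat. \<exists>C. \<forall>x\<in>grid \<epsilon>. norm x ^ n * norm (u x t) \<le> C) \<and>
     (\<forall>x\<in>grid \<epsilon>. \<exists>u'. continuous_on {0..} u' \<and>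
        (\<forall>t\<ge>0. (u x has_vector_derivative u' t) (at t within {0..})) \<and>
        (\<forall>t>0. u' t + difference_op l L a \<epsilon> (\<lambda>z. u z t) x = 0)) \<and>
     (\<forall>x\<in>grid \<epsilon>. u x 0 = (if x = 0 then 1 / of_real \<epsilon> ^ CARD('d) else 0))"

end

theory Submission
  imports Defs "HOL-Probability.Giry_Monad" "HOL-Probability.Sinc_Integral"
begin

text \<open>
  The Green function equals its Fourier integral over the cube of side \<open>2 \<pi> / \<epsilon>\<close>, since bounded
  solutions of the Cauchy problem are unique. With \<open>t = \<tau>\<^sup>l\<close> and \<open>\<xi> = \<tau> \<eta>\<close> it becomes \<open>\<tau>\<close> to the power \<open>-d\<close>
  times the same integral at time \<open>1\<close> with mesh width \<open>s = \<epsilon> / \<tau>\<close>. Testing the approximation hypothesis on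
  exponentials gives \<open>A(\<theta>) - \<A>(\<theta>) = O(|\<theta>|^(l + M))\<close>, and both real parts are at least
  \<open>c |\<theta>|\<^sup>l\<close>, so the integrands at time \<open>1\<close> differ by at most
  \<open>C s\<^sup>M (1 + |\<xi>|)^(l + M) exp (- c |\<xi>|\<^sup>l)\<close>; outside the cube the factor \<open>s\<^sup>M\<close> comes from
  \<open>s |\<xi>| \<ge> 1\<close>. Integrating and using \<open>s \<le> \<epsilon>\<^sub>0 / \<tau>\<close> yields the claim.
\<close>

text \<open>The unknown solution is never Fourier transformed: \<open>discrete_green\<close> gives
  decay in x separately for each t, so a series over the grid could not simply be differentiated in
  t. Instead the two candidates are subtracted and measured in the supremum norm over the grid,
  where, for a fixed mesh, the difference operator is bounded and the Cauchy problem behaves like an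
  ordinary differential equation. The operator bound depends on the mesh width, which is harmless
  because uniqueness concerns one mesh at a time. Exponentials are eigenfunctions of both operators,
  so an error between operators becomes an error between symbols; since they have modulus 1, all
  later estimates are uniform in x. Coercivity of A has two sources: near 0 consistency of order at
  least 1 transfers ellipticity, and on the rest of the cube positivity and compactness supply it.
  The rate comes from homogeneity: an error |\<theta>|^(l + M) at \<theta> = s \<xi>, divided by
  s^l, is s^M |\<xi>|^(l + M).\<close>

section \<open>Uniqueness of pointwise bounded solutions\<close>

text \<open>
  Any bound \<open>B\<close> on the segment improves to \<open>G + B / 2\<close>, by the mean value inequality.
\<close>

lemma norm_le_twice_on_short_segment:
  fixes w :: "'x \<Rightarrow> real \<Rightarrow> complex"
  assumes C: "C > 0" and seg: "closed_segment c e \<subseteq> {0..}" and len: "\<bar>e - c\<bar> \<le> 1 / (2 * C)"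
    and cont: "\<And>x. x \<in> X \<Longrightarrow> continuous_on {0..} (w x)"
    and deriv: "\<And>x t. x \<in> X \<Longrightarrow> t > 0 \<Longrightarrow> \<exists>w'. (w x has_vector_derivative w') (at t) \<and>
                  (\<forall>K. (\<forall>y\<in>X. norm (w y t) \<le> K) \<longrightarrow> norm w' \<le> C * K)"
    and bdd: "\<And>x t. x \<in> X \<Longrightarrow> t \<in> closed_segment c e \<Longrightarrow> norm (w x t) \<le> K"
    and start: "\<And>x. x \<in> X \<Longrightarrow> norm (w x c) \<le> G"
    and x: "x \<in> X" "t \<in> closed_segment c e"
  shows "norm (w x t) \<le> 2 * G"
proof -
  have lip: "norm (w y r - w y s) \<le> C * B * \<bar>r - s\<bar>"
    if y: "y \<in> X" and B: "\<And>x t. x \<in> X \<Longrightarrow> t \<in> closed_segment c e \<Longrightarrow> norm (w x t) \<le> B"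
      and rs: "s < r" "s \<in> closed_segment c e" "r \<in> closed_segment c e" for y r s B
  proof -
    have sub: "{s..r} \<subseteq> closed_segment c e"
      using rs by (auto simp: closed_segment_eq_real_ivl split: if_splits)
    have pos: "0 \<le> s" using rs seg by auto
    define D where "D t = (SOME w'. (w y has_vector_derivative w') (at t) \<and>
                  (\<forall>K. (\<forall>y\<in>X. norm (w y t) \<le> K) \<longrightarrow> norm w' \<le> C * K))" for t
    have D: "(w y has_vector_derivative D t) (at t) \<and>
                  (\<forall>K. (\<forall>y\<in>X. norm (w y t) \<le> K) \<longrightarrow> norm (D t) \<le> C * K)" if "t > 0" for t
      unfolding D_def by (rule someI_ex[OF deriv[OF y that]])
    \<comment> \<open>The mean value point lies strictly between s and r, hence is positive, so the
      derivative hypothesis applies there even if s = 0.\<close>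
    have "\<exists>x\<in>{s<..<r}. norm (w y r - w y s) \<le> norm ((r - s) *\<^sub>R D x)"
      using rs(1)
    proof (rule mvt_general[where f' = "\<lambda>t h. h *\<^sub>R D t"])
      show "continuous_on {s..r} (w y)"
        using cont[OF y] pos by (elim continuous_on_subset) auto
      show "(w y has_derivative (\<lambda>h. h *\<^sub>R D t)) (at t)" if "s < t" "t < r" for t
        using D[of t] pos that by (auto simp: has_vector_derivative_def)
    qed
    then obtain t where t: "s < t" "t < r" "norm (w y r - w y s) \<le> norm ((r - s) *\<^sub>R D t)"
      by auto
    have "t \<in> closed_segment c e" using t sub by (simp add: subset_iff)
    hence "\<forall>y\<in>X. norm (w y t) \<le> B" using B by blast
    hence "norm (D t) \<le> C * B" using D[of t] t pos by auto
    hence "norm ((r - s) *\<^sub>R D t) \<le> (r - s) * (C * B)"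
      using rs by (simp add: mult_left_mono)
    from order_trans[OF t(3) this] show ?thesis using rs by (simp add: mult_ac)
  qed
  have step: "norm (w y r) \<le> G + B / 2"
    if y: "y \<in> X" and B: "\<And>x t. x \<in> X \<Longrightarrow> t \<in> closed_segment c e \<Longrightarrow> norm (w x t) \<le> B"
      and r: "r \<in> closed_segment c e" for y r B
  proof -
    have B0: "B \<ge> 0" using B[OF y r] norm_ge_zero order_trans by blast
    have c: "c \<in> closed_segment c e" by simp
    \<comment> \<open>\<open>closed_segment c e\<close> allows e < c, so the estimate also runs
      backward in time; the Baire argument below uses both directions.\<close>
    have "norm (w y r - w y c) \<le> C * B * \<bar>r - c\<bar>"
    proof (cases r c rule: linorder_cases)
      case less thus ?thesis using lip[OF y B less r c] by (simp add: norm_minus_commute abs_minus_commute)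
    next
      case greater thus ?thesis using lip[OF y B greater c r] by simp
    qed auto
    also have "\<dots> \<le> C * B * (1 / (2 * C))"
      using len r B0 C
      by (intro mult_left_mono) (auto simp: closed_segment_eq_real_ivl split: if_splits)
    also have "\<dots> = B / 2" using C by simp
    finally show ?thesis using start[OF y] norm_triangle_sub[of "w y r" "w y c"] by linarith
  qed
  \<comment> \<open>The map B to G + B / 2 has the fixed point 2 G and halves the distance to it, so
    the a priori bound K disappears in the limit.\<close>
  have iter: "\<forall>x\<in>X. \<forall>t\<in>closed_segment c e. norm (w x t) \<le> 2 * G + K / 2 ^ n" for n
  proof (induction n)
    case 0
    have "0 \<le> G" using start[OF x(1)] norm_ge_zero order_trans by blast
    thus ?case using bdd by force
  next
    case (Suc n)
    show ?case
    proof (intro ballI)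
      fix y r assume "y \<in> X" "r \<in> closed_segment c e"
      from step[OF this(1) _ this(2), of "2 * G + K / 2 ^ n"] Suc
      show "norm (w y r) \<le> 2 * G + K / 2 ^ Suc n" by (auto simp: field_simps)
    qed
  qed
  have "(\<lambda>n. 2 * G + K * (1 / 2) ^ n) \<longlonglongrightarrow> 2 * G + K * 0"
    by (intro tendsto_intros LIMSEQ_power_zero) auto
  thus ?thesis
    using iter x by (intro LIMSEQ_le_const[of _ "2 * G"]) (auto simp: field_simps)
qed

text \<open>Finite subcover; the sum of the absolute values of the local bounds dominates each of
  them and also makes sense for an empty cover.\<close>

lemma uniformly_bounded_on_compact:
  fixes w :: "'x \<Rightarrow> real \<Rightarrow> complex"
  assumes "compact S" and S0: "S \<subseteq> {0..}"
    and loc: "\<And>t. t \<in> S \<Longrightarrow> \<exists>\<delta>>0. \<exists>K. \<forall>x\<in>X. \<forall>s\<ge>0. \<bar>s - t\<bar> < \<delta> \<longrightarrow> norm (w x s) \<le> K"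
  shows "\<exists>K. \<forall>x\<in>X. \<forall>s\<in>S. norm (w x s) \<le> K"
proof -
  from loc obtain d where d: "\<And>t. t \<in> S \<Longrightarrow> d t > 0 \<and>
      (\<exists>K. \<forall>x\<in>X. \<forall>s\<ge>0. \<bar>s - t\<bar> < d t \<longrightarrow> norm (w x s) \<le> K)"
    by metis
  then obtain B where B: "\<And>t x s. t \<in> S \<Longrightarrow> x \<in> X \<Longrightarrow> s \<ge> 0 \<Longrightarrow> \<bar>s - t\<bar> < d t \<Longrightarrow> norm (w x s) \<le> B t"
    by metis
  have "S \<subseteq> (\<Union>t\<in>S. ball t (d t))" using d by force
  from compactE_image[OF \<open>compact S\<close> _ this]
  obtain F where F: "F \<subseteq> S" "finite F" "S \<subseteq> (\<Union>t\<in>F. ball t (d t))" by auto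
  have "norm (w x s) \<le> (\<Sum>t\<in>F. \<bar>B t\<bar>)" if "x \<in> X" "s \<in> S" for x s
  proof -
    from F(3) that obtain t where t: "t \<in> F" "\<bar>s - t\<bar> < d t" by (auto simp: dist_real_def abs_minus_commute)
    have "norm (w x s) \<le> \<bar>B t\<bar>" using B[of t x s] t F that S0 by force
    also have "\<dots> \<le> (\<Sum>t\<in>F. \<bar>B t\<bar>)" using t F by (intro member_le_sum) auto
    finally show ?thesis .
  qed
  thus ?thesis by blast
qed

text \<open>
  The solution is only assumed to be bounded in \<open>x\<close> for each fixed \<open>t\<close>, without any uniformity in
  \<open>t\<close>. Let \<open>E\<close> be the closed set of times near which it is not uniformly bounded. By Baire's theorem
  a single bound \<open>n\<close> holds on a nonempty relatively open part of \<open>E\<close>; a nearby time outside \<open>E\<close> is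
  joined to the closest point of \<open>E\<close> by a short segment, on which the doubling estimate gives the
  bound \<open>2 n\<close>. Hence the solution is bounded near a point of \<open>E\<close>, so \<open>E\<close> is empty.
\<close>

theorem zero_if_pointwise_bounded:
  fixes w :: "'x \<Rightarrow> real \<Rightarrow> complex"
  assumes C: "C > 0"
    and cont: "\<And>x. x \<in> X \<Longrightarrow> continuous_on {0..} (w x)"
    and bdd: "\<And>t. t \<ge> 0 \<Longrightarrow> \<exists>K. \<forall>x\<in>X. norm (w x t) \<le> K"
    and deriv: "\<And>x t. x \<in> X \<Longrightarrow> t > 0 \<Longrightarrow> \<exists>w'. (w x has_vector_derivative w') (at t) \<and>
                  (\<forall>K. (\<forall>y\<in>X. norm (w y t) \<le> K) \<longrightarrow> norm w' \<le> C * K)"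
    and zero: "\<And>x. x \<in> X \<Longrightarrow> w x 0 = 0"
    and x: "x \<in> X" and t: "t \<ge> 0"
  shows "w x t = 0"
proof -
  note double = norm_le_twice_on_short_segment[OF C _ _ cont deriv]
  define E where "E = {t\<in>{0..}. \<not> (\<exists>\<delta>>0. \<exists>K. \<forall>x\<in>X. \<forall>s\<ge>0. \<bar>s - t\<bar> < \<delta> \<longrightarrow> norm (w x s) \<le> K)}"
  have "closed E"
    unfolding closed_sequential_limits
  proof (intro allI impI, elim conjE)
    fix f l assume f: "\<forall>n::nat. f n \<in> E" and l: "f \<longlonglongrightarrow> l"
    have "l \<ge> 0" using f l by (intro LIMSEQ_le_const[of f l]) (auto simp: E_def)
    moreover have False if dK: "\<delta> > 0" "\<forall>x\<in>X. \<forall>s\<ge>0. \<bar>s - l\<bar> < \<delta> \<longrightarrow> norm (w x s) \<le> K" for \<delta> K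
    proof -
      obtain n where n: "\<bar>f n - l\<bar> < \<delta> / 2"
        using LIMSEQ_D[OF l, of "\<delta> / 2"] dK by auto
      have "\<bar>s - l\<bar> < \<delta>" if "\<bar>s - f n\<bar> < \<delta> / 2" for s using n that by linarith
      hence "\<forall>x\<in>X. \<forall>s\<ge>0. \<bar>s - f n\<bar> < \<delta> / 2 \<longrightarrow> norm (w x s) \<le> K" using dK by blast
      hence "f n \<notin> E" using half_gt_zero[OF dK(1)] unfolding E_def by blast
      with f show False by blast
    qed
    ultimately show "l \<in> E" unfolding E_def by blast
  qed
  define F where "F n = {t\<in>E. \<forall>x\<in>X. norm (w x t) \<le> real n}" for n
  have "closed (F n)" for n
  proof -
    have "closed (E \<inter> {t\<in>{0..}. norm (w x t) \<le> real n})" if "x \<in> X" for x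
      using \<open>closed E\<close> cont[OF that]
      by (intro closed_Int continuous_on_closed_Collect_le continuous_intros) auto
    \<comment> \<open>The outer intersection with E matters for empty X, where the intersection over
      X is the whole line.\<close>
    hence "closed (E \<inter> (\<Inter>x\<in>X. E \<inter> {t\<in>{0..}. norm (w x t) \<le> real n}))"
      using \<open>closed E\<close> by (intro closed_Int closed_INT) auto
    also have "E \<inter> (\<Inter>x\<in>X. E \<inter> {t\<in>{0..}. norm (w x t) \<le> real n}) = F n"
      by (auto simp: F_def E_def)
    finally show ?thesis .
  qed
  have EF: "\<exists>n. t \<in> F n" if tE: "t \<in> E" for t
  proof -
    obtain K where K: "\<forall>x\<in>X. norm (w x t) \<le> K" using bdd[of t] tE by (auto simp: E_def)
    obtain n where "K \<le> real n" using real_arch_simple by blast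
    with K have "\<forall>x\<in>X. norm (w x t) \<le> real n" by (meson order_trans)
    with tE show ?thesis by (auto simp: F_def)
  qed
  have "E = {}"
  proof (rule ccontr)
    assume "E \<noteq> {}"
    \<comment> \<open>Otherwise the relatively open sets \<open>E - F n\<close> are all dense in E,
      so by Baire their intersection is dense as well; but it is empty because the sets
      \<open>F n\<close> cover E.\<close>
    have "\<exists>n. \<not> E \<subseteq> closure (E - F n)"
    proof (rule ccontr)
      assume "\<not> ?thesis"
      hence dense: "E \<subseteq> closure (E - F n)" for n by auto
      have "E \<subseteq> closure (\<Inter>(range (\<lambda>n. E - F n)))"
      proof (rule Baire[OF \<open>closed E\<close>])
        fix T assume "T \<in> range (\<lambda>n. E - F n)"
        then obtain n where "T = E - F n" by auto
        moreover have "openin (top_of_set E) (E - F n)"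
          using \<open>closed (F n)\<close> by (metis Diff_eq open_Compl openin_open_Int)
        ultimately show "openin (top_of_set E) T \<and> E \<subseteq> closure T" using dense by auto
      qed auto
      moreover have "\<Inter>(range (\<lambda>n. E - F n)) = {}" using EF by auto
      ultimately show False using \<open>E \<noteq> {}\<close> by (metis closure_empty subset_empty)
    qed
    then obtain n t0 where t0: "t0 \<in> E" "t0 \<notin> closure (E - F n)" by auto
    then obtain r where r: "r > 0" "\<And>t. t \<in> E - F n \<Longrightarrow> \<not> dist t t0 < r"
      by (auto simp: closure_approachable)
    \<comment> \<open>With h at most r, the points of E between t and t0 lie in \<open>F n\<close>;
      with h at most 1 / (2 C), the doubling estimate applies on the segments below.\<close>
    define h where "h = min r (1 / (2 * C))"
    have h: "h > 0" "h \<le> r" "h \<le> 1 / (2 * C)" using r C by (auto simp: h_def)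
    have "norm (w x t) \<le> 2 * real n" if "x \<in> X" "t \<ge> 0" "\<bar>t - t0\<bar> < h" for x t
    proof -
      have "compact (E \<inter> closed_segment t t0)"
        using \<open>closed E\<close> by (intro closed_Int_compact) auto
      then obtain e where e: "e \<in> E \<inter> closed_segment t t0"
        and e_min: "\<And>y. y \<in> E \<inter> closed_segment t t0 \<Longrightarrow> dist t e \<le> dist t y"
        using distance_attains_inf[OF compact_imp_closed, of "E \<inter> closed_segment t t0" t] t0 by auto
      have t0p: "t0 \<ge> 0" using t0 by (auto simp: E_def)
      have et: "closed_segment t e \<subseteq> {0..}" "\<bar>e - t\<bar> \<le> 1 / (2 * C)" "\<bar>e - t0\<bar> < r"
        using e that h t0p by (auto simp: closed_segment_eq_real_ivl split: if_splits)
      have e_n: "norm (w y e) \<le> n" if "y \<in> X" for y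
        using r(2)[of e] e et(3) that by (auto simp: F_def dist_real_def)
      obtain G where G: "\<forall>y\<in>X. norm (w y t) \<le> G" using bdd[OF \<open>t \<ge> 0\<close>] by auto
      \<comment> \<open>Before e the segment avoids E, so compactness bounds the solution on each
        piece from t to s, but with a bound that may degenerate as s tends to e. Doubling from t
        replaces it by 2 G, independent of s.\<close>
      have near: "norm (w y s) \<le> max (2 * G) n" if y: "y \<in> X" and s: "s \<in> closed_segment t e" for y s
      proof (cases "s = e")
        case True thus ?thesis using e_n[OF y] by simp
      next
        case False
        have sub: "closed_segment t s \<subseteq> closed_segment t e" using s by (simp add: subset_closed_segment)
        have notE: "z \<notin> E" if z: "z \<in> closed_segment t s" for z
          using e_min[of z] e z s False
          by (auto simp: closed_segment_eq_real_ivl dist_real_def split: if_splits)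
        have "\<exists>K. \<forall>x\<in>X. \<forall>s\<in>closed_segment t s. norm (w x s) \<le> K"
        proof (rule uniformly_bounded_on_compact)
          show "closed_segment t s \<subseteq> {0..}" using sub et by auto
          show "\<exists>\<delta>>0. \<exists>K. \<forall>x\<in>X. \<forall>s\<ge>0. \<bar>s - z\<bar> < \<delta> \<longrightarrow> norm (w x s) \<le> K"
            if "z \<in> closed_segment t s" for z
            using notE[OF that] that sub et unfolding E_def by blast
        qed auto
        then obtain K where K: "\<And>x z. x\<in>X \<Longrightarrow> z\<in>closed_segment t s \<Longrightarrow> norm (w x z) \<le> K" by blast
        have "norm (w y s) \<le> 2 * G"
        proof (rule double[where c = t and e = s and K = K])
          show "\<bar>s - t\<bar> \<le> 1 / (2 * C)"
            using s et(2) by (auto simp: closed_segment_eq_real_ivl split: if_splits)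
        qed (use K G y sub et in auto)
        thus ?thesis by simp
      qed
      \<comment> \<open>Now doubling starts at e and runs to t. The a priori bound still depends on
        t through G, but the conclusion sees only the value n at e.\<close>
      show ?thesis
      proof (rule double[where c = e and e = t and K = "max (2 * G) n"])
        show "closed_segment e t \<subseteq> {0..}" "\<bar>t - e\<bar> \<le> 1 / (2 * C)"
          using et by (auto simp: closed_segment_commute abs_minus_commute)
      qed (use near e_n that in \<open>auto simp: closed_segment_commute\<close>)
    qed
    with t0(1) h(1) show False unfolding E_def by blast
  qed
  define h where "h = 1 / (2 * C)"
  have h: "h > 0" using C by (simp add: h_def)
  \<comment> \<open>With E empty every compact time interval has some uniform bound, and doubling
    the initial value 0 over steps of length h gives 0 again.\<close>
  have zero_at: "\<forall>x\<in>X. \<forall>s\<in>{0..real n * h}. w x s = 0" for n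
  proof (induction n)
    case 0 thus ?case using zero by auto
  next
    case (Suc n)
    have "\<exists>K. \<forall>x\<in>X. \<forall>s\<in>{0..real (Suc n) * h}. norm (w x s) \<le> K"
    proof (rule uniformly_bounded_on_compact)
      show "\<exists>\<delta>>0. \<exists>K. \<forall>x\<in>X. \<forall>s\<ge>0. \<bar>s - t\<bar> < \<delta> \<longrightarrow> norm (w x s) \<le> K"
        if "t \<in> {0..real (Suc n) * h}" for t
      proof -
        have "t \<ge> 0" using that by simp
        thus ?thesis using \<open>E = {}\<close> unfolding E_def by blast
      qed
    qed auto
    then obtain K where K: "\<And>x s. x\<in>X \<Longrightarrow> s\<in>{0..real (Suc n) * h} \<Longrightarrow> norm (w x s) \<le> K" by blast
    have seg: "closed_segment (real n * h) (real (Suc n) * h) = {real n * h..real (Suc n) * h}"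
      using h by (auto simp: closed_segment_eq_real_ivl)
    have nh: "0 \<le> real n * h" using h by simp
    have "norm (w y s) \<le> 2 * 0" if "y \<in> X" "s \<in> {real n * h..real (Suc n) * h}" for y s
    proof (rule double[where c = "real n * h" and e = "real (Suc n) * h" and K = K])
      show "\<bar>real (Suc n) * h - real n * h\<bar> \<le> 1 / (2 * C)"
      proof -
        have "real (Suc n) * h - real n * h = h" by (simp add: algebra_simps)
        thus ?thesis using h by (simp add: h_def)
      qed
      show "norm (w z s) \<le> K" if "z \<in> X" "s \<in> closed_segment (real n * h) (real (Suc n) * h)" for z s
        using K that nh unfolding seg by auto
      show "norm (w z (real n * h)) \<le> 0" if "z \<in> X" for z
        using Suc that nh by auto
    qed (use that nh in \<open>auto simp: seg simp del: of_nat_Suc\<close>)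
    thus ?case using Suc by (metis atLeastAtMost_iff linear mult_zero_right norm_le_zero_iff)
  qed
  obtain n where "t / h \<le> real n" using real_arch_simple by blast
  thus ?thesis using zero_at[of n] x t h by (auto simp: field_simps)
qed

section \<open>Operators acting on superpositions of exponentials\<close>

abbreviation osc :: "real ^ 'd::finite \<Rightarrow> real ^ 'd \<Rightarrow> complex" where
  "osc y \<xi> \<equiv> exp (\<i> * of_real (y \<bullet> \<xi>))"

abbreviation (input) cube :: "real \<Rightarrow> (real ^ 'd::finite) set" where
  "cube r \<equiv> cbox (vec (- r)) (vec r)"

text \<open>
  A general measure \<open>\<mu>\<close> lets one computation serve both the single exponentials, where \<open>\<mu>\<close> is a
  point mass, and the Fourier integrals over the cube.
\<close>

definition superpos :: "(real ^ 'd::finite) measure \<Rightarrow> (real ^ 'd \<Rightarrow> complex) \<Rightarrow> real ^ 'd \<Rightarrow> complex" where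
  "superpos \<mu> g y = (LINT \<xi>|\<mu>. g \<xi> * osc y \<xi>)"

lemma norm_osc [simp]: "norm (osc y \<xi>) = 1"
  by (simp add: norm_exp_eq_Re)

lemma borel_measurable_osc [measurable]: "osc y \<in> borel_measurable borel"
  by (intro borel_measurable_continuous_onI continuous_intros)

lemma integrable_osc:
  assumes "sets \<mu> = sets borel" "integrable \<mu> g"
  shows "integrable \<mu> (\<lambda>\<xi>. g \<xi> * osc y \<xi>)"
proof (rule Bochner_Integration.integrable_bound[OF assms(2)])
  have "osc y \<in> borel_measurable \<mu>"
    unfolding measurable_cong_sets[OF assms(1) refl] by measurable
  thus "(\<lambda>\<xi>. g \<xi> * osc y \<xi>) \<in> borel_measurable \<mu>"
    using assms(2) by measurable
qed (simp add: norm_mult)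

lemma osc_shift: "osc (y + s *\<^sub>R axis k 1) \<xi> = exp (\<i> * of_real (s * \<xi> $ k)) * osc y \<xi>"
  by (simp add: inner_add_left inner_axis' flip: exp_add) (simp add: algebra_simps)

text \<open>P carries the side condition, later integrability: the integral of a non-integrable
  function is 0 by convention, so the intertwining relation is available only under P, and P has to
  survive each step.\<close>

lemma funpow_intertwine:
  assumes "\<And>g. P g \<Longrightarrow> P (F g) \<and> T (\<Phi> g) = \<Phi> (F g)" and "P g"
  shows "P ((F ^^ n) g) \<and> (T ^^ n) (\<Phi> g) = \<Phi> ((F ^^ n) g)"
  using assms by (induction n) auto

lemma funpow_mult_fun: "((\<lambda>(g :: 'a \<Rightarrow> complex) \<xi>. f \<xi> * g \<xi>) ^^ n) g = (\<lambda>\<xi>. f \<xi> ^ n * g \<xi>)"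
  by (induction n arbitrary: g) (auto simp: mult_ac)

text \<open>Under \<Phi> the operators become pointwise multiplications. These commute, so the order
  of the coordinates disappears and a product over \<open>UNIV\<close> remains.\<close>

lemma ordered_comp_multiplier:
  fixes T :: "'d::{finite,linorder} \<Rightarrow> 'f \<Rightarrow> 'f" and f :: "'d \<Rightarrow> 'a \<Rightarrow> complex"
  assumes "\<And>k g. P g \<Longrightarrow> P (\<lambda>\<xi>. f k \<xi> * g \<xi>) \<and> T k (\<Phi> g) = \<Phi> (\<lambda>\<xi>. f k \<xi> * g \<xi>)" and "P g"
  shows "P (\<lambda>\<xi>. (\<Prod>k\<in>UNIV. f k \<xi>) * g \<xi>) \<and> ordered_comp T (\<Phi> g) = \<Phi> (\<lambda>\<xi>. (\<Prod>k\<in>UNIV. f k \<xi>) * g \<xi>)"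
proof -
  have "P (\<lambda>\<xi>. (\<Prod>k\<in>set ks. f k \<xi>) * g \<xi>) \<and> foldr T ks (\<Phi> g) = \<Phi> (\<lambda>\<xi>. (\<Prod>k\<in>set ks. f k \<xi>) * g \<xi>)"
    if "distinct ks" for ks
    using that
  proof (induction ks)
    case (Cons k ks)
    then show ?case using assms(1)[of "\<lambda>\<xi>. (\<Prod>k\<in>set ks. f k \<xi>) * g \<xi>" k]
      by (simp add: mult.assoc)
  qed (use assms in simp)
  from this[of "sorted_list_of_set UNIV"] show ?thesis by (simp add: ordered_comp_def)
qed

section \<open>Difference operators as multipliers\<close>

definition minus_factor :: "real \<Rightarrow> 'd::finite \<Rightarrow> real ^ 'd \<Rightarrow> complex" where
  "minus_factor \<epsilon> k \<xi> = exp (- \<i> * of_real (\<epsilon> * \<xi> $ k)) - 1"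

definition plus_factor :: "real \<Rightarrow> 'd::finite \<Rightarrow> real ^ 'd \<Rightarrow> complex" where
  "plus_factor \<epsilon> k \<xi> = exp (\<i> * of_real (\<epsilon> * \<xi> $ k)) - 1"

text \<open>A shift multiplies \<open>osc\<close> by a phase of modulus 1, so the factor is bounded
  by 2 and integrability survives. The sign of s is free, which covers both kinds of
  differences.\<close>

lemma superpos_shift:
  fixes s :: real and k :: "'d::finite"
  assumes "sets \<mu> = sets borel" "integrable \<mu> g"
  defines "f \<equiv> \<lambda>\<xi>. exp (\<i> * of_real (s * \<xi> $ k)) - 1"
  shows "integrable \<mu> (\<lambda>\<xi>. f \<xi> * g \<xi>)"
    and "superpos \<mu> g (y + s *\<^sub>R axis k 1) - superpos \<mu> g y = superpos \<mu> (\<lambda>\<xi>. f \<xi> * g \<xi>) y"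
proof -
  have [measurable]: "f \<in> borel_measurable \<mu>"
    unfolding measurable_cong_sets[OF assms(1) refl] f_def
    by (intro borel_measurable_continuous_onI continuous_intros)
  have "norm (f \<xi>) \<le> 2" for \<xi>
    unfolding f_def using norm_triangle_ineq4[of "exp (\<i> * of_real (s * \<xi> $ k))" 1]
    by (simp add: norm_exp_eq_Re del: of_real_mult)
  hence le: "norm (f \<xi>) * norm (g \<xi>) \<le> 2 * norm (g \<xi>)" for \<xi>
    by (intro mult_right_mono) auto
  show int: "integrable \<mu> (\<lambda>\<xi>. f \<xi> * g \<xi>)"
    by (rule Bochner_Integration.integrable_bound[where f = "\<lambda>\<xi>. 2 * norm (g \<xi>)"])
       (use assms(2) le in \<open>auto simp: norm_mult\<close>)
  show "superpos \<mu> g (y + s *\<^sub>R axis k 1) - superpos \<mu> g y = superpos \<mu> (\<lambda>\<xi>. f \<xi> * g \<xi>) y"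
  proof -
    have "f \<xi> * g \<xi> * osc y \<xi> = g \<xi> * osc (y + s *\<^sub>R axis k 1) \<xi> - g \<xi> * osc y \<xi>" for \<xi>
      unfolding osc_shift f_def by (simp add: algebra_simps)
    thus ?thesis
      using integrable_osc[OF assms(1,2)] by (simp add: superpos_def)
  qed
qed

lemma delta_superpos:
  assumes "sets \<mu> = sets borel" "integrable \<mu> g"
  shows "integrable \<mu> (\<lambda>\<xi>. minus_factor \<epsilon> k \<xi> * g \<xi>) \<and>
           delta_minus \<epsilon> k (superpos \<mu> g) = superpos \<mu> (\<lambda>\<xi>. minus_factor \<epsilon> k \<xi> * g \<xi>)"
    and "integrable \<mu> (\<lambda>\<xi>. plus_factor \<epsilon> k \<xi> * g \<xi>) \<and>
           delta_plus \<epsilon> k (superpos \<mu> g) = superpos \<mu> (\<lambda>\<xi>. plus_factor \<epsilon> k \<xi> * g \<xi>)"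
  using superpos_shift[OF assms, where s = "- \<epsilon>" and k = k] superpos_shift[OF assms, where s = \<epsilon> and k = k]
  by (auto simp: minus_factor_def plus_factor_def delta_minus_def delta_plus_def)

lemma delta_multi_superpos:
  fixes g :: "(real, 'd::{finite,linorder}) vec \<Rightarrow> complex" and \<epsilon> :: real
  assumes \<mu>: "sets \<mu> = sets borel" and g: "integrable \<mu> g"
  defines "f \<equiv> \<lambda>\<nu> \<xi>. \<Prod>k\<in>UNIV. minus_factor \<epsilon> k \<xi> ^ \<nu> (Inl k) * plus_factor \<epsilon> k \<xi> ^ \<nu> (Inr k)"
  shows "integrable \<mu> (\<lambda>\<xi>. f \<nu> \<xi> * g \<xi>) \<and>
         delta_multi \<epsilon> \<nu> (superpos \<mu> g) = superpos \<mu> (\<lambda>\<xi>. f \<nu> \<xi> * g \<xi>)"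
  unfolding delta_multi_def f_def
proof (rule ordered_comp_multiplier[where P = "integrable \<mu>"])
  fix k :: 'd and g :: "(real, 'd) vec \<Rightarrow> complex" assume g: "integrable \<mu> g"
  note plus = funpow_intertwine[where P = "integrable \<mu>" and T = "delta_plus \<epsilon> k" and \<Phi> = "superpos \<mu>"
      and F = "\<lambda>g \<xi>. plus_factor \<epsilon> k \<xi> * g \<xi>", OF delta_superpos(2)[OF \<mu>, of _ \<epsilon> k] g,
      of "\<nu> (Inr k)", unfolded funpow_mult_fun]
  note minus = funpow_intertwine[where P = "integrable \<mu>" and T = "delta_minus \<epsilon> k" and \<Phi> = "superpos \<mu>"
      and F = "\<lambda>g \<xi>. minus_factor \<epsilon> k \<xi> * g \<xi>", OF delta_superpos(1)[OF \<mu>, of _ \<epsilon> k] conjunct1[OF plus],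
      of "\<nu> (Inl k)", unfolded funpow_mult_fun]
  from plus minus
  show "integrable \<mu> (\<lambda>\<xi>. minus_factor \<epsilon> k \<xi> ^ \<nu> (Inl k) * plus_factor \<epsilon> k \<xi> ^ \<nu> (Inr k) * g \<xi>) \<and>
    (delta_minus \<epsilon> k ^^ \<nu> (Inl k) \<circ> delta_plus \<epsilon> k ^^ \<nu> (Inr k)) (superpos \<mu> g) =
      superpos \<mu> (\<lambda>\<xi>. minus_factor \<epsilon> k \<xi> ^ \<nu> (Inl k) * plus_factor \<epsilon> k \<xi> ^ \<nu> (Inr k) * g \<xi>)"
    by (simp add: mult.assoc)
qed fact

lemma difference_op_superpos:
  fixes g :: "(real, 'd::{finite,linorder}) vec \<Rightarrow> complex"
  assumes \<mu>: "sets \<mu> = sets borel" and g: "integrable \<mu> g"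
  shows "difference_op l L a \<epsilon> (superpos \<mu> g) y =
         1 / of_real \<epsilon> ^ l * superpos \<mu> (\<lambda>\<xi>. difference_symbol l L a (\<epsilon> *\<^sub>R \<xi>) * g \<xi>) y"
proof -
  define f :: "('d + 'd \<Rightarrow> nat) \<Rightarrow> (real, 'd) vec \<Rightarrow> complex"
    where "f \<nu> \<xi> = (\<Prod>k\<in>UNIV. minus_factor \<epsilon> k \<xi> ^ \<nu> (Inl k) * plus_factor \<epsilon> k \<xi> ^ \<nu> (Inr k))" for \<nu> \<xi>
  have sym: "difference_symbol l L a (\<epsilon> *\<^sub>R \<xi>) = (\<Sum>\<nu> | l \<le> mi_size \<nu> \<and> mi_size \<nu> \<le> L. a \<nu> * f \<nu> \<xi>)" for \<xi>
    by (simp add: difference_symbol_def f_def minus_factor_def plus_factor_def)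
  have f: "integrable \<mu> (\<lambda>\<xi>. f \<nu> \<xi> * g \<xi>)" "delta_multi \<epsilon> \<nu> (superpos \<mu> g) = superpos \<mu> (\<lambda>\<xi>. f \<nu> \<xi> * g \<xi>)" for \<nu>
    using delta_multi_superpos[OF \<mu> g, of \<epsilon> \<nu>] by (simp_all add: f_def)
  have "superpos \<mu> (\<lambda>\<xi>. difference_symbol l L a (\<epsilon> *\<^sub>R \<xi>) * g \<xi>) y =
      (LINT \<xi>|\<mu>. (\<Sum>\<nu> | l \<le> mi_size \<nu> \<and> mi_size \<nu> \<le> L. a \<nu> * (f \<nu> \<xi> * g \<xi> * osc y \<xi>)))"
    by (simp add: superpos_def sym sum_distrib_right mult.assoc)
  also have "\<dots> = (\<Sum>\<nu> | l \<le> mi_size \<nu> \<and> mi_size \<nu> \<le> L. a \<nu> * superpos \<mu> (\<lambda>\<xi>. f \<nu> \<xi> * g \<xi>) y)"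
    unfolding superpos_def using integrable_osc[OF \<mu> f(1)]
    by (subst Bochner_Integration.integral_sum) auto
  finally show ?thesis by (simp add: difference_op_def f(2))
qed

lemma continuous_difference_symbol: "continuous_on S (difference_symbol l L a)"
  unfolding difference_symbol_def by (intro continuous_intros)

section \<open>Single exponentials as test functions\<close>

lemma superpos_return:
  assumes "g \<in> borel_measurable borel"
  shows "superpos (return borel \<xi>) g y = g \<xi> * osc y \<xi>"
  unfolding superpos_def using assms by (subst integral_return) auto

lemma difference_op_osc:
  "difference_op l L a \<epsilon> (\<lambda>y. osc y \<xi>) y = 1 / of_real \<epsilon> ^ l * difference_symbol l L a (\<epsilon> *\<^sub>R \<xi>) * osc y \<xi>"
proof -
  have "integrable (return borel \<xi>) (\<lambda>_. 1 :: complex)"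
    by (intro finite_measure.integrable_const prob_space.finite_measure prob_space_return) auto
  note * = difference_op_superpos[OF _ this, of l L a \<epsilon> y]
  have "superpos (return borel \<xi>) (\<lambda>_. 1) = (\<lambda>y. osc y \<xi>)"
    by (rule ext) (simp add: superpos_return)
  moreover have "(\<lambda>\<xi>. difference_symbol l L a (\<epsilon> *\<^sub>R \<xi>) * 1) \<in> borel_measurable borel"
    by (intro borel_measurable_continuous_onI continuous_intros
        continuous_on_compose2[OF continuous_difference_symbol[of UNIV]]) auto
  ultimately show ?thesis using * by (simp add: superpos_return)
qed

text \<open>The constant c makes the family closed under differentiation, so that the result can be
  iterated along any list of coordinates.\<close>

lemma partial_deriv_osc:
  "((\<lambda>s. c * osc (y + s *\<^sub>R axis k 1) \<xi>) has_vector_derivative (\<i> * of_real (\<xi> $ k) * c) * osc y \<xi>) (at 0)"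
  "partial_deriv k (\<lambda>y. c * osc y \<xi>) = (\<lambda>y. (\<i> * of_real (\<xi> $ k) * c) * osc y \<xi>)"
proof -
  show *: "((\<lambda>s. c * osc (y + s *\<^sub>R axis k 1) \<xi>) has_vector_derivative (\<i> * of_real (\<xi> $ k) * c) * osc y \<xi>) (at 0)" for y
  proof -
    have "((\<lambda>z. c * (exp (\<i> * (z * of_real (\<xi> $ k))) * osc y \<xi>)) has_field_derivative
        (\<i> * of_real (\<xi> $ k) * c) * osc y \<xi>) (at (of_real 0))"
      by (auto intro!: derivative_eq_intros)
    from has_vector_derivative_real_field[OF this] show ?thesis by (simp add: osc_shift)
  qed
  show "partial_deriv k (\<lambda>y. c * osc y \<xi>) = (\<lambda>y. (\<i> * of_real (\<xi> $ k) * c) * osc y \<xi>)"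
    by (simp add: partial_deriv_def fun_eq_iff vector_derivative_at[OF *])
qed

lemma bounded_smooth_osc: "bounded_smooth (\<lambda>y. osc y \<xi>)"
proof -
  have ex: "\<exists>c. foldr partial_deriv ks (\<lambda>y. osc y \<xi>) = (\<lambda>y. c * osc y \<xi>)" for ks
  proof (induction ks)
    case Nil show ?case by (rule exI[of _ 1]) simp
  next
    case (Cons k ks)
    then show ?case by (auto simp: partial_deriv_osc(2))
  qed
  show ?thesis
    unfolding bounded_smooth_def Let_def
  proof (intro allI)
    fix ks
    obtain c where c: "foldr partial_deriv ks (\<lambda>y. osc y \<xi>) = (\<lambda>y. c * osc y \<xi>)" using ex by blast
    have "bounded (range (\<lambda>y. c * osc y \<xi>))"
      by (rule boundedI[of _ "norm c"]) (auto simp: norm_mult)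
    moreover have "continuous_on UNIV (\<lambda>y. c * osc y \<xi>)"
      by (intro continuous_intros)
    ultimately show "continuous_on UNIV (foldr partial_deriv ks (\<lambda>y. osc y \<xi>)) \<and>
       bounded (range (foldr partial_deriv ks (\<lambda>y. osc y \<xi>))) \<and>
       (\<forall>k y. (\<lambda>s. foldr partial_deriv ks (\<lambda>y. osc y \<xi>) (y + s *\<^sub>R axis k 1)) differentiable at 0)"
      unfolding c using differentiableI_vector[OF partial_deriv_osc(1)] by blast
  qed
qed

lemma diff_op_osc: "diff_op l b (\<lambda>y. osc y \<xi>) y = diff_symbol l b \<xi> * osc y \<xi>"
proof -
  \<comment> \<open>A scalar c is encoded as a function on a dummy type, read off at 0. This lets
    \<open>ordered_comp_multiplier\<close> and \<open>funpow_intertwine\<close> be reused for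
    operators that multiply a fixed exponential by constants; the side condition is then trivially
    true.\<close>
  define \<Phi> :: "(nat \<Rightarrow> complex) \<Rightarrow> (real, 'a) vec \<Rightarrow> complex" where "\<Phi> g = (\<lambda>y. g 0 * osc y \<xi>)" for g
  have D: "True \<and> D_op k (\<Phi> g) = \<Phi> (\<lambda>u. of_real (\<xi> $ k) * g u)" for k g
    by (simp add: \<Phi>_def D_op_def partial_deriv_osc(2) fun_eq_iff flip: mult.assoc)
  have "D_multi \<alpha> (\<Phi> (\<lambda>_. 1)) = \<Phi> (\<lambda>u. (\<Prod>k\<in>UNIV. of_real (\<xi> $ k) ^ \<alpha> k) * 1)" for \<alpha>
    unfolding D_multi_def
  proof (rule conjunct2[OF ordered_comp_multiplier[where P = "\<lambda>_. True"]])
    show "True \<and> (D_op k ^^ \<alpha> k) (\<Phi> g) = \<Phi> (\<lambda>u. of_real (\<xi> $ k) ^ \<alpha> k * g u)" for k g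
      using funpow_intertwine[where P = "\<lambda>_. True" and T = "D_op k" and \<Phi> = \<Phi>
        and F = "\<lambda>g u. of_real (\<xi> $ k) * g u", OF D, where g = g and n = "\<alpha> k", unfolded funpow_mult_fun] by simp
  qed simp
  thus ?thesis by (simp add: diff_op_def diff_symbol_def \<Phi>_def sum_distrib_right mult.assoc)
qed

section \<open>Difference operators in the supremum norm over the grid\<close>

lemma delta_multi_linear_bound:
  fixes u v :: "(real, 'd::{finite,linorder}) vec \<Rightarrow> complex"
  shows "delta_multi \<epsilon> \<nu> (\<lambda>y. u y - v y) y = delta_multi \<epsilon> \<nu> u y - delta_multi \<epsilon> \<nu> v y"
    and "\<exists>B\<ge>0. \<forall>u K. (\<forall>y\<in>grid \<epsilon>. norm (u y) \<le> K) \<longrightarrow> (\<forall>y\<in>grid \<epsilon>. norm (delta_multi \<epsilon> \<nu> u y) \<le> B * K)"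
proof -
  \<comment> \<open>\<open>R\<close> bundles subtractivity and boundedness into a property closed
    under composition, so it passes from single differences to powers and to the ordered product.
    The single differences have it because shifts by the mesh width preserve the grid.\<close>
  define R where "R T \<longleftrightarrow> (\<forall>u v. T (\<lambda>y. u y - v y) = (\<lambda>y. T u y - T v y)) \<and>
     (\<exists>B\<ge>0. \<forall>u K. (\<forall>y\<in>grid \<epsilon>. norm (u y) \<le> K) \<longrightarrow> (\<forall>y\<in>grid \<epsilon>. norm (T u y) \<le> B * K))"
    for T :: "((real, 'd) vec \<Rightarrow> complex) \<Rightarrow> (real, 'd) vec \<Rightarrow> complex"
  have comp: "R (S \<circ> T)" if "R S" "R T" for S T
  proof -
    from \<open>R S\<close> obtain A where A: "A \<ge> 0"
      "\<forall>u K. (\<forall>y\<in>grid \<epsilon>. norm (u y) \<le> K) \<longrightarrow> (\<forall>y\<in>grid \<epsilon>. norm (S u y) \<le> A * K)"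
      unfolding R_def by blast
    from \<open>R T\<close> obtain B where B: "B \<ge> 0"
      "\<forall>u K. (\<forall>y\<in>grid \<epsilon>. norm (u y) \<le> K) \<longrightarrow> (\<forall>y\<in>grid \<epsilon>. norm (T u y) \<le> B * K)"
      unfolding R_def by blast
    have "A * B \<ge> 0 \<and> (\<forall>u K. (\<forall>y\<in>grid \<epsilon>. norm (u y) \<le> K) \<longrightarrow> (\<forall>y\<in>grid \<epsilon>. norm ((S \<circ> T) u y) \<le> A * B * K))"
      using A B by (simp add: mult.assoc)
    moreover have "(S \<circ> T) (\<lambda>y. u y - v y) = (\<lambda>y. (S \<circ> T) u y - (S \<circ> T) v y)" for u v
      using that by (simp add: R_def)
    ultimately show ?thesis unfolding R_def by blast
  qed
  have R_id: "R (\<lambda>u. u)" unfolding R_def by (auto intro!: exI[of _ 1])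
  have pow: "R (T ^^ n)" if "R T" for T n
    using comp[OF that] R_id by (induction n) (auto simp: id_def)
  have shift: "y + \<epsilon> *\<^sub>R axis k 1 \<in> grid \<epsilon>" "y - \<epsilon> *\<^sub>R axis k 1 \<in> grid \<epsilon>" if "y \<in> grid \<epsilon>" for y :: "(real,'d) vec" and k
  proof -
    have "\<forall>j. \<exists>m::int. y $ j = \<epsilon> * of_int m" using \<open>y \<in> grid \<epsilon>\<close> by (simp add: grid_def)
    then obtain m :: "'d \<Rightarrow> int" where "\<And>j. y $ j = \<epsilon> * of_int (m j)" by metis
    hence "(y + \<epsilon> *\<^sub>R axis k 1) $ j = \<epsilon> * of_int (m j + (if j = k then 1 else 0))"
      "(y - \<epsilon> *\<^sub>R axis k 1) $ j = \<epsilon> * of_int (m j - (if j = k then 1 else 0))" for j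
      by (auto simp: axis_def algebra_simps)
    thus "y + \<epsilon> *\<^sub>R axis k 1 \<in> grid \<epsilon>" "y - \<epsilon> *\<^sub>R axis k 1 \<in> grid \<epsilon>" unfolding grid_def by blast+
  qed
  have tri: "norm (p - q) \<le> 2 * K" if "norm p \<le> K" "norm q \<le> K" for p q :: complex and K
    using norm_triangle_ineq4[of p q] that by linarith
  have "R (delta_minus \<epsilon> k)" "R (delta_plus \<epsilon> k)" for k
    unfolding R_def delta_minus_def delta_plus_def
    by (auto intro!: exI[of _ 2] tri simp: shift)
  hence "R ((delta_minus \<epsilon> k ^^ \<nu> (Inl k)) \<circ> (delta_plus \<epsilon> k ^^ \<nu> (Inr k)))" for k
    by (intro comp pow)
  hence "R (foldr (\<lambda>k. (delta_minus \<epsilon> k ^^ \<nu> (Inl k)) \<circ> (delta_plus \<epsilon> k ^^ \<nu> (Inr k))) ks)" for ks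
    by (induction ks) (use R_id comp in \<open>auto simp: id_def\<close>)
  hence "R (delta_multi \<epsilon> \<nu>)" unfolding delta_multi_def ordered_comp_def fun_eq_iff[symmetric] by simp
  thus "delta_multi \<epsilon> \<nu> (\<lambda>y. u y - v y) y = delta_multi \<epsilon> \<nu> u y - delta_multi \<epsilon> \<nu> v y"
    "\<exists>B\<ge>0. \<forall>u K. (\<forall>y\<in>grid \<epsilon>. norm (u y) \<le> K) \<longrightarrow> (\<forall>y\<in>grid \<epsilon>. norm (delta_multi \<epsilon> \<nu> u y) \<le> B * K)"
    by (auto simp: R_def)
qed

lemma difference_op_diff:
  "difference_op l L a \<epsilon> (\<lambda>y. u y - v y) x = difference_op l L a \<epsilon> u x - difference_op l L a \<epsilon> v x"
  by (simp add: difference_op_def delta_multi_linear_bound(1) algebra_simps sum_subtractf)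

lemma difference_op_bounded:
  fixes a :: "('d::{finite,linorder} + 'd \<Rightarrow> nat) \<Rightarrow> complex"
  shows "\<exists>C>0. \<forall>u K. (\<forall>y\<in>grid \<epsilon>. norm (u y) \<le> K) \<longrightarrow> (\<forall>x\<in>grid \<epsilon>. norm (difference_op l L a \<epsilon> u x) \<le> C * K)"
proof -
  obtain B where B: "\<And>\<nu> u K x. (\<forall>y\<in>grid \<epsilon>. norm (u y) \<le> K) \<Longrightarrow> x \<in> grid \<epsilon> \<Longrightarrow>
      norm (delta_multi \<epsilon> \<nu> u (x :: (real,'d) vec)) \<le> B \<nu> * K" and B0: "\<And>\<nu>. B \<nu> \<ge> 0"
    using delta_multi_linear_bound(2)[where 'd = 'd, of \<epsilon>] by metis
  define S where "S = (\<Sum>\<nu> | l \<le> mi_size \<nu> \<and> mi_size \<nu> \<le> L. norm (a \<nu>) * B \<nu>)"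
  \<comment> \<open>The summand 1 makes C positive, as the uniqueness theorem demands.\<close>
  define C where "C = norm (1 / of_real \<epsilon> ^ l :: complex) * S + 1"
  have S0: "S \<ge> 0" unfolding S_def by (intro sum_nonneg mult_nonneg_nonneg B0) auto
  have "norm (difference_op l L a \<epsilon> u x) \<le> C * K"
    if u: "\<forall>y\<in>grid \<epsilon>. norm (u y) \<le> K" and x: "x \<in> grid \<epsilon>" for u K x
  proof -
    have K: "K \<ge> 0" using u x norm_ge_zero order_trans by blast
    have "norm (\<Sum>\<nu> | l \<le> mi_size \<nu> \<and> mi_size \<nu> \<le> L. a \<nu> * delta_multi \<epsilon> \<nu> u x) \<le>
        (\<Sum>\<nu> | l \<le> mi_size \<nu> \<and> mi_size \<nu> \<le> L. norm (a \<nu>) * B \<nu> * K)"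
      by (intro sum_norm_le) (auto simp: norm_mult mult.assoc intro!: mult_left_mono B u x)
    also have "\<dots> = S * K" by (simp add: S_def sum_distrib_right)
    finally have "norm (difference_op l L a \<epsilon> u x) \<le> norm (1 / of_real \<epsilon> ^ l :: complex) * (S * K)"
      unfolding difference_op_def norm_mult by (intro mult_left_mono) auto
    also have "\<dots> \<le> C * K" using K by (simp add: C_def algebra_simps)
    finally show ?thesis .
  qed
  moreover have "C > 0" using S0 by (simp add: C_def add_nonneg_pos)
  ultimately show ?thesis by blast
qed

section \<open>The Green function as a Fourier integral\<close>

text \<open>Fubini for products of one-variable functions, used for the initial values and for the
  integrable majorant.\<close>

lemma lborel_integral_prod_cart:
  fixes f :: "'d::finite \<Rightarrow> real \<Rightarrow> 'b::{real_normed_field,banach,second_countable_topology}"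
  assumes f: "\<And>k. integrable lborel (f k)"
  shows "integrable lborel (\<lambda>x :: real ^ 'd. \<Prod>k\<in>UNIV. f k (x $ k))"
    and "(LINT x|lborel. (\<Prod>k\<in>UNIV. f k (x $ k))) = (\<Prod>k\<in>UNIV. LINT s|lborel. f k s)"
proof -
  interpret product_sigma_finite "\<lambda>_ :: real ^ 'd. lborel :: real measure" ..
  \<comment> \<open>\<open>lborel\<close> is the image of a product measure indexed by
    \<open>Basis\<close>; \<iota> translates basis vectors back to coordinates.\<close>
  define \<iota> where "\<iota> b = (THE k. b = axis k (1::real))" for b :: "real ^ 'd"
  have \<iota>: "\<iota> (axis k 1) = k" for k
    unfolding \<iota>_def by (rule the_equality) (auto simp: axis_eq_axis)
  have Basis: "(Basis :: (real ^ 'd) set) = range (\<lambda>k. axis k 1)" by (auto simp: Basis_vec_def)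
  have inj: "inj (\<lambda>k. axis k 1 :: real ^ 'd)" by (auto simp: inj_def axis_eq_axis)
  have prod: "(\<Prod>b\<in>Basis. p b) = (\<Prod>k\<in>UNIV. p (axis k 1))" for p :: "real ^ 'd \<Rightarrow> 'b"
    unfolding Basis by (subst prod.reindex[OF inj]) simp
  have nth: "(\<Sum>b\<in>Basis. h b *\<^sub>R b) $ k = h (axis k 1)" for h and k :: 'd
    unfolding Basis by (subst sum.reindex[OF inj]) (simp add: axis_def if_distrib cong: if_cong)
  have [measurable]: "f k \<in> borel_measurable borel" for k
    using borel_measurable_integrable[OF f[of k]] by simp
  have nth_meas [measurable]: "(\<lambda>x :: real ^ 'd. x $ k) \<in> borel_measurable borel" for k
    by (intro borel_measurable_continuous_onI continuous_intros)
  have meas: "(\<lambda>x :: real ^ 'd. \<Prod>k\<in>UNIV. f k (x $ k)) \<in> borel_measurable borel"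
    by measurable
  have meas': "(\<lambda>h. \<Sum>b\<in>Basis. h b *\<^sub>R b) \<in> (\<Pi>\<^sub>M b\<in>Basis. lborel) \<rightarrow>\<^sub>M (borel :: (real ^ 'd) measure)"
    by measurable
  have eq: "(\<Prod>k\<in>UNIV. f k ((\<Sum>b\<in>Basis. h b *\<^sub>R b) $ k)) = (\<Prod>b\<in>Basis. f (\<iota> b) (h b))" for h
    by (simp only: nth prod \<iota>)
  show "integrable lborel (\<lambda>x :: real ^ 'd. \<Prod>k\<in>UNIV. f k (x $ k))"
    by (subst lborel_eq, subst integrable_distr_eq[OF meas' meas], unfold eq)
       (intro product_integrable_prod f finite_Basis)
  show "(LINT x|lborel. (\<Prod>k\<in>UNIV. f k (x $ k))) = (\<Prod>k\<in>UNIV. LINT s|lborel. f k s)"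
    by (subst lborel_eq, subst integral_distr[OF meas' meas], unfold eq,
        subst product_integral_prod[OF finite_Basis f]) (simp add: prod \<iota>)
qed

text \<open>The cube enters as an indicator, so that the integral runs over the whole space and can
  be compared pointwise with the integrand of the heat profile.\<close>

definition green_density :: "nat \<Rightarrow> nat \<Rightarrow> (('d::finite + 'd \<Rightarrow> nat) \<Rightarrow> complex) \<Rightarrow> real \<Rightarrow> real \<Rightarrow> real ^ 'd \<Rightarrow> complex" where
  "green_density l L a \<epsilon> t \<eta> =
     indicator (cube (pi / \<epsilon>)) \<eta> * exp (- of_real (t / \<epsilon> ^ l) * difference_symbol l L a (\<epsilon> *\<^sub>R \<eta>))"

definition green_integral :: "nat \<Rightarrow> nat \<Rightarrow> (('d::finite + 'd \<Rightarrow> nat) \<Rightarrow> complex) \<Rightarrow> real \<Rightarrow> real ^ 'd \<Rightarrow> real \<Rightarrow> complex" where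
  "green_integral l L a \<epsilon> x t =
     1 / (2 * of_real pi) ^ CARD('d) * superpos lborel (green_density l L a \<epsilon> t) x"

section \<open>The Fourier integral solves the Cauchy problem\<close>

lemma continuous_difference_symbol_comp [continuous_intros]:
  "continuous_on S f \<Longrightarrow> continuous_on S (\<lambda>x. difference_symbol l L a (f x))"
  by (rule continuous_on_compose2[OF continuous_difference_symbol[of UNIV]]) auto

lemma integrable_green_density: "integrable lborel (green_density l L a \<epsilon> t)"
proof -
  have "integrable lborel (\<lambda>\<eta>. indicator (cube (pi / \<epsilon>)) \<eta> *\<^sub>R
      exp (- of_real (t / \<epsilon> ^ l) * difference_symbol l L a (\<epsilon> *\<^sub>R \<eta>)))"
    by (intro borel_integrable_compact compact_cbox continuous_intros)
  also have "(\<lambda>\<eta>. indicator (cube (pi / \<epsilon>)) \<eta> *\<^sub>R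
      exp (- of_real (t / \<epsilon> ^ l) * difference_symbol l L a (\<epsilon> *\<^sub>R \<eta>))) = green_density l L a \<epsilon> t"
    by (auto simp: green_density_def indicator_def fun_eq_iff)
  finally show ?thesis .
qed

lemma indicator_scaleR_complex: "indicator S x *\<^sub>R (z :: complex) = indicator S x * z"
  by (simp add: indicator_def)

text \<open>Passes from the Lebesgue integral to the gauge integral, for which the Leibniz rule is
  stated.\<close>

lemma superpos_cube:
  fixes h :: "real ^ 'd::finite \<Rightarrow> complex"
  assumes "continuous_on (cube r) h"
  shows "superpos lborel (\<lambda>\<eta>. indicator (cube r) \<eta> * h \<eta>) x = integral (cube r) (\<lambda>\<eta>. h \<eta> * osc x \<eta>)"
proof -
  have "set_integrable lborel (cube r) (\<lambda>\<eta>. h \<eta> * osc x \<eta>)"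
    unfolding set_integrable_def by (intro borel_integrable_compact compact_cbox continuous_intros assms)
  from set_borel_integral_eq_integral(2)[OF this] show ?thesis
    by (simp add: superpos_def set_lebesgue_integral_def indicator_scaleR_complex mult.assoc)
qed

text \<open>Differentiating under the integral multiplies the density by minus the rescaled symbol,
  which is, up to sign, what the difference operator does to a superposition.\<close>

lemma green_integral_derivative:
  fixes a :: "('d::{finite,linorder} + 'd \<Rightarrow> nat) \<Rightarrow> complex"
  shows "(green_integral l L a \<epsilon> x has_vector_derivative
           - difference_op l L a \<epsilon> (\<lambda>z. green_integral l L a \<epsilon> z t) x) (at t)"
proof -
  let ?A = "\<lambda>\<eta>. difference_symbol l L a (\<epsilon> *\<^sub>R \<eta>)"
  let ?e = "\<lambda>t \<eta>. exp (- of_real (t / \<epsilon> ^ l) * ?A \<eta>)"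
  define c :: complex where "c = 1 / (2 * of_real pi) ^ CARD('d)"
  have green: "green_integral l L a \<epsilon> x t = c * integral (cube (pi / \<epsilon>)) (\<lambda>\<eta>. ?e t \<eta> * osc x \<eta>)" for t
    unfolding green_integral_def c_def green_density_def
    by (subst superpos_cube) (intro continuous_intros refl)+
  have "((\<lambda>t. integral (cube (pi / \<epsilon>)) (\<lambda>\<eta>. ?e t \<eta> * osc x \<eta>)) has_vector_derivative
      integral (cube (pi / \<epsilon>)) (\<lambda>\<eta>. - (1 / of_real \<epsilon> ^ l * ?A \<eta> * ?e t \<eta>) * osc x \<eta>)) (at t)"
  proof (rule leibniz_rule_vector_derivative[where U = UNIV])
    show "((\<lambda>t. ?e t \<eta> * osc x \<eta>) has_vector_derivative - (1 / of_real \<epsilon> ^ l * ?A \<eta> * ?e t \<eta>) * osc x \<eta>) (at t)"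
      for t \<eta>
    proof -
      have "((\<lambda>z. exp (- (z / of_real \<epsilon> ^ l) * ?A \<eta>) * osc x \<eta>) has_field_derivative
          - (1 / of_real \<epsilon> ^ l * ?A \<eta> * ?e t \<eta>) * osc x \<eta>) (at (of_real t))"
        by (auto intro!: derivative_eq_intros simp: divide_inverse)
      from has_vector_derivative_real_field[OF this] show ?thesis by simp
    qed
    show "(\<lambda>\<eta>. ?e t \<eta> * osc x \<eta>) integrable_on cube (pi / \<epsilon>)" for t
      by (intro integrable_continuous continuous_intros)
    show "continuous_on (UNIV \<times> cube (pi / \<epsilon>)) (\<lambda>(t, \<eta>). - (1 / of_real \<epsilon> ^ l * ?A \<eta> * ?e t \<eta>) * osc x \<eta>)"
      unfolding case_prod_beta divide_inverse by (intro continuous_intros)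
  qed auto
  hence "(green_integral l L a \<epsilon> x has_vector_derivative
      c * integral (cube (pi / \<epsilon>)) (\<lambda>\<eta>. - (1 / of_real \<epsilon> ^ l * ?A \<eta> * ?e t \<eta>) * osc x \<eta>)) (at t)"
    unfolding green by (rule has_vector_derivative_mult_right)
  also have "integral (cube (pi / \<epsilon>)) (\<lambda>\<eta>. - (1 / of_real \<epsilon> ^ l * ?A \<eta> * ?e t \<eta>) * osc x \<eta>) =
      - (1 / of_real \<epsilon> ^ l) * superpos lborel (\<lambda>\<eta>. ?A \<eta> * green_density l L a \<epsilon> t \<eta>) x"
  proof -
    have "superpos lborel (\<lambda>\<eta>. ?A \<eta> * green_density l L a \<epsilon> t \<eta>) x =
        superpos lborel (\<lambda>\<eta>. indicator (cube (pi / \<epsilon>)) \<eta> * (?A \<eta> * ?e t \<eta>)) x"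
      by (simp add: green_density_def mult_ac)
    also have "\<dots> = integral (cube (pi / \<epsilon>)) (\<lambda>\<eta>. ?A \<eta> * ?e t \<eta> * osc x \<eta>)"
      by (subst superpos_cube) (intro continuous_intros refl)+
    finally show ?thesis
      by (simp add: mult.assoc flip: integral_mult_right)
  qed
  also have "c * (- (1 / of_real \<epsilon> ^ l) * superpos lborel (\<lambda>\<eta>. ?A \<eta> * green_density l L a \<epsilon> t \<eta>) x) =
      - difference_op l L a \<epsilon> (\<lambda>z. green_integral l L a \<epsilon> z t) x"
  proof -
    have "(\<lambda>z. green_integral l L a \<epsilon> z t) = superpos lborel (\<lambda>\<eta>. c * green_density l L a \<epsilon> t \<eta>)"
      by (rule ext) (simp add: green_integral_def superpos_def c_def mult.assoc)
    moreover have "superpos lborel (\<lambda>\<eta>. ?A \<eta> * (c * green_density l L a \<epsilon> t \<eta>)) x =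
        c * superpos lborel (\<lambda>\<eta>. ?A \<eta> * green_density l L a \<epsilon> t \<eta>) x"
      unfolding superpos_def by (subst Bochner_Integration.integral_mult_right_zero[symmetric]) (simp add: mult_ac)
    ultimately show ?thesis
      using difference_op_superpos[of lborel "\<lambda>\<eta>. c * green_density l L a \<epsilon> t \<eta>" l L a \<epsilon> x]
        integrable_green_density[of l L a \<epsilon> t] by simp
  qed
  finally show ?thesis .
qed

text \<open>Orthogonality of characters: at a grid frequency \<epsilon> m the interval of length 2
  pi / \<epsilon> contains exactly |m| periods, so the antiderivative agrees at both ends unless m =
  0.\<close>

lemma integral_exp_grid:
  assumes "\<epsilon> > 0"
  shows "(LINT s|lborel. indicator {- (pi / \<epsilon>)..pi / \<epsilon>} s * exp (\<i> * of_real (\<epsilon> * of_int m * s))) =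
    (if m = 0 then of_real (2 * pi / \<epsilon>) else (0 :: complex))"
proof -
  let ?f = "\<lambda>s. exp (\<i> * of_real (\<epsilon> * of_int m * s)) :: complex"
  have int: "set_integrable lborel {- (pi / \<epsilon>)..pi / \<epsilon>} ?f"
    unfolding set_integrable_def by (intro borel_integrable_compact compact_Icc continuous_intros)
  have "(LINT s|lborel. indicator {- (pi / \<epsilon>)..pi / \<epsilon>} s * ?f s) = integral {- (pi / \<epsilon>)..pi / \<epsilon>} ?f"
    using set_borel_integral_eq_integral(2)[OF int]
    by (simp add: set_lebesgue_integral_def indicator_scaleR_complex)
  also have "\<dots> = (if m = 0 then of_real (2 * pi / \<epsilon>) else 0)"
  proof (cases "m = 0")
    case True
    thus ?thesis using assms by (simp add: scaleR_conv_of_real)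
  next
    case False
    let ?k = "\<i> * of_real (\<epsilon> * of_int m) :: complex"
    have k: "?k \<noteq> 0" using False assms by simp
    have "(?f has_integral exp (?k * of_real (pi / \<epsilon>)) / ?k - exp (?k * of_real (- (pi / \<epsilon>))) / ?k) {- (pi / \<epsilon>)..pi / \<epsilon>}"
    proof (rule fundamental_theorem_of_calculus)
      show "((\<lambda>s. exp (?k * of_real s) / ?k) has_vector_derivative ?f s) (at s within {- (pi / \<epsilon>)..pi / \<epsilon>})" for s
      proof (rule has_vector_derivative_real_field)
        show "((\<lambda>z. exp (?k * z) / ?k) has_field_derivative ?f s) (at (of_real s))"
          using k by (auto intro!: derivative_eq_intros simp: mult_ac)
      qed
    qed (use assms in simp)
    moreover have "exp (?k * of_real (pi / \<epsilon>)) = exp (?k * of_real (- (pi / \<epsilon>)))"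
    proof -
      have "exp (?k * of_real (pi / \<epsilon>)) = exp (?k * of_real (- (pi / \<epsilon>)) + of_int (2 * m) * of_real pi * \<i>)"
        using assms by (intro arg_cong[where f = exp]) (simp add: field_simps)
      also have "\<dots> = exp (?k * of_real (- (pi / \<epsilon>)))"
        by (subst exp_add) (simp add: exp_integer_2pi[of "of_int m"] mult_ac exp_eq_1)
      finally show ?thesis .
    qed
    ultimately show ?thesis using False by (simp add: has_integral_iff)
  qed
  finally show ?thesis .
qed

text \<open>At time 0 the density is the indicator of the cube, so the integral factors over the
  coordinates, and one nonzero coordinate of x makes the product vanish.\<close>

lemma green_integral_0:
  fixes a :: "('d::finite + 'd \<Rightarrow> nat) \<Rightarrow> complex"
  assumes \<epsilon>: "\<epsilon> > 0" and x: "x \<in> grid \<epsilon>"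
  shows "green_integral l L a \<epsilon> x 0 = (if x = 0 then 1 / of_real \<epsilon> ^ CARD('d) else 0)"
proof -
  have "\<forall>k. \<exists>m::int. x $ k = \<epsilon> * of_int m" using x by (simp add: grid_def)
  then obtain m :: "'d \<Rightarrow> int" where m: "\<And>k. x $ k = \<epsilon> * of_int (m k)" by metis
  let ?f = "\<lambda>k s. indicator {- (pi / \<epsilon>)..pi / \<epsilon>} s * exp (\<i> * of_real (\<epsilon> * of_int (m k) * s)) :: complex"
  have int: "integrable lborel (?f k)" for k
  proof -
    have "integrable lborel (\<lambda>s. indicator {- (pi / \<epsilon>)..pi / \<epsilon>} s *\<^sub>R exp (\<i> * of_real (\<epsilon> * of_int (m k) * s)) :: complex)"
      by (intro borel_integrable_compact compact_Icc continuous_intros)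
    thus ?thesis by (simp only: indicator_scaleR_complex)
  qed
  have prod_ind: "(\<Prod>k\<in>UNIV. indicator {- r..r} (\<eta> $ k)) = (indicator (cube r) \<eta> :: complex)" for r and \<eta> :: "real ^ 'd"
    by (auto simp: indicator_def mem_box_cart)
  have "superpos lborel (green_density l L a \<epsilon> 0) x = (LINT \<eta>|lborel. (\<Prod>k\<in>UNIV. ?f k (\<eta> $ k)))"
    unfolding superpos_def prod.distrib prod_ind
    by (simp add: green_density_def inner_vec_def m sum_distrib_left exp_sum)
  also have "\<dots> = (\<Prod>k\<in>UNIV. if m k = 0 then of_real (2 * pi / \<epsilon>) else 0)"
    by (subst lborel_integral_prod_cart(2)[OF int]) (simp only: integral_exp_grid[OF \<epsilon>])
  also have "\<dots> = (if x = 0 then of_real (2 * pi / \<epsilon>) ^ CARD('d) else 0)"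
    using \<epsilon> by (auto simp: vec_eq_iff m)
  finally show ?thesis
    using \<epsilon> by (simp add: green_integral_def power_divide power_mult_distrib)
qed

text \<open>By linearity the difference of both functions solves the same equation with initial
  value 0; the grid bound of \<open>difference_op\<close> is the derivative hypothesis of
  \<open>zero_if_pointwise_bounded\<close>.\<close>

theorem discrete_green_unique:
  fixes a :: "('d::{finite,linorder} + 'd \<Rightarrow> nat) \<Rightarrow> complex"
  assumes \<epsilon>: "\<epsilon> > 0" and u: "discrete_green l L a \<epsilon> u" and x: "x \<in> grid \<epsilon>" and t: "t \<ge> 0"
  shows "u x t = green_integral l L a \<epsilon> x t"
proof -
  let ?v = "green_integral l L a \<epsilon>"
  obtain C where C: "C > 0" "\<And>u K x. (\<forall>y\<in>grid \<epsilon>. norm (u y) \<le> K) \<Longrightarrow> x \<in> grid \<epsilon> \<Longrightarrow>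
      norm (difference_op l L a \<epsilon> u x) \<le> C * K"
    using difference_op_bounded[of \<epsilon> l L a] by metis
  have du: "\<exists>u'. (\<forall>t\<ge>0. (u x has_vector_derivative u' t) (at t within {0..})) \<and>
        (\<forall>t>0. u' t + difference_op l L a \<epsilon> (\<lambda>z. u z t) x = 0)" if "x \<in> grid \<epsilon>" for x
    using u that unfolding discrete_green_def by blast
  have "u x t - ?v x t = 0"
  proof (rule zero_if_pointwise_bounded[where X = "grid \<epsilon>" and w = "\<lambda>x t. u x t - ?v x t", OF C(1)])
    fix x :: "(real, 'd) vec" assume x: "x \<in> grid \<epsilon>"
    obtain u' where u': "\<And>t. t \<ge> 0 \<Longrightarrow> (u x has_vector_derivative u' t) (at t within {0..})"
      "\<And>t. t > 0 \<Longrightarrow> u' t + difference_op l L a \<epsilon> (\<lambda>z. u z t) x = 0"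
      using du[OF x] by auto
    have "continuous_on {0..} (u x)"
      using u'(1) by (auto simp: continuous_on_eq_continuous_within intro: has_vector_derivative_continuous)
    moreover have "continuous_on {0..} (?v x)"
      using green_integral_derivative[of l L a \<epsilon> x]
      by (auto intro!: continuous_at_imp_continuous_on intro: has_vector_derivative_continuous)
    ultimately show "continuous_on {0..} (\<lambda>t. u x t - ?v x t)" by (intro continuous_intros)
    show "u x 0 - ?v x 0 = 0"
      using u x green_integral_0[OF \<epsilon> x, of l L a] by (auto simp: discrete_green_def)
    fix t :: real assume t: "t > 0"
    have "at t within {0..} = at t"
      by (rule at_within_interior) (use t in simp)
    hence "(u x has_vector_derivative u' t) (at t)"
      using u'(1)[of t] t by simp
    moreover have "u' t = - difference_op l L a \<epsilon> (\<lambda>z. u z t) x"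
      using u'(2)[OF t] by (simp add: eq_neg_iff_add_eq_0)
    ultimately have "(u x has_vector_derivative - difference_op l L a \<epsilon> (\<lambda>z. u z t) x) (at t)"
      by simp
    from has_vector_derivative_diff[OF this green_integral_derivative]
    have "((\<lambda>t. u x t - ?v x t) has_vector_derivative
        - difference_op l L a \<epsilon> (\<lambda>z. u z t) x - - difference_op l L a \<epsilon> (\<lambda>z. ?v z t) x) (at t)" .
    also have "- difference_op l L a \<epsilon> (\<lambda>z. u z t) x - - difference_op l L a \<epsilon> (\<lambda>z. ?v z t) x =
        - difference_op l L a \<epsilon> (\<lambda>z. u z t - ?v z t) x"
      by (simp add: difference_op_diff)
    finally show "\<exists>w'. ((\<lambda>t. u x t - ?v x t) has_vector_derivative w') (at t) \<and>
        (\<forall>K. (\<forall>y\<in>grid \<epsilon>. norm (u y t - ?v y t) \<le> K) \<longrightarrow> norm w' \<le> C * K)"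
      using C(2)[OF _ x, of "\<lambda>z. u z t - ?v z t"]
      by (intro exI[of _ "- difference_op l L a \<epsilon> (\<lambda>z. u z t - ?v z t) x"] conjI allI impI)
         (simp_all only: norm_minus_cancel)
  next
    fix t :: real assume "t \<ge> 0"
    \<comment> \<open>Decay with exponent 0 is boundedness in x at this t; K may depend on
      t.\<close>
    then obtain K where K: "\<forall>x\<in>grid \<epsilon>. norm x ^ 0 * norm (u x t) \<le> K"
      using u unfolding discrete_green_def by blast
    define I where "I = norm (1 / (2 * of_real pi) ^ CARD('d) :: complex) *
      (LINT \<eta>|lborel. norm (green_density l L a \<epsilon> t \<eta>))"
    have "norm (?v x t) \<le> I" for x
    proof -
      have "norm (superpos lborel (green_density l L a \<epsilon> t) x) \<le> (LINT \<eta>|lborel. norm (green_density l L a \<epsilon> t \<eta> * osc x \<eta>))"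
        unfolding superpos_def by (rule integral_norm_bound)
      thus ?thesis by (simp add: I_def green_integral_def norm_mult divide_right_mono norm_divide)
    qed
    hence "\<forall>x\<in>grid \<epsilon>. norm (u x t - ?v x t) \<le> K + I"
      using K by (auto intro!: order_trans[OF norm_triangle_ineq4] add_mono)
    thus "\<exists>K. \<forall>x\<in>grid \<epsilon>. norm (u x t - ?v x t) \<le> K" by blast
  qed (use x t in auto)
  thus ?thesis by simp
qed

section \<open>Comparison of the symbols\<close>

text \<open>Adding one exponential at a time lets the Taylor estimate be proved by induction over
  the terms, without expanding the difference symbol explicitly.\<close>

inductive trig_poly :: "(real ^ 'd::finite \<Rightarrow> complex) \<Rightarrow> bool" where
  zero: "trig_poly (\<lambda>_. 0)"
| add: "trig_poly F \<Longrightarrow> trig_poly (\<lambda>\<theta>. c * osc m \<theta> + F \<theta>)"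

lemma trig_poly_sum_two: "trig_poly F \<Longrightarrow> trig_poly G \<Longrightarrow> trig_poly (\<lambda>\<theta>. F \<theta> + G \<theta>)"
  by (induction rule: trig_poly.induct) (auto simp: add.assoc intro: trig_poly.intros)

lemma trig_poly_mult_osc: "trig_poly F \<Longrightarrow> trig_poly (\<lambda>\<theta>. c * osc m \<theta> * F \<theta>)"
proof (induction rule: trig_poly.induct)
  case (add F c' m')
  have "c * osc m \<theta> * (c' * osc m' \<theta> + F \<theta>) = c * c' * osc (m + m') \<theta> + c * osc m \<theta> * F \<theta>" for \<theta>
    by (simp add: inner_add_left distrib_left exp_add)
  with trig_poly.add[OF add.IH] show ?case by simp
qed (simp add: trig_poly.zero)

lemma trig_poly_mult: "trig_poly F \<Longrightarrow> trig_poly G \<Longrightarrow> trig_poly (\<lambda>\<theta>. F \<theta> * G \<theta>)"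
  by (induction rule: trig_poly.induct)
     (auto simp: distrib_right intro: trig_poly.zero trig_poly_sum_two trig_poly_mult_osc)

lemma trig_poly_osc: "trig_poly (\<lambda>\<theta>. c * osc m \<theta>)"
  using trig_poly.add[OF trig_poly.zero] by simp

lemma trig_poly_const: "trig_poly (\<lambda>_. c)"
  using trig_poly_osc[of c 0] by simp

lemma trig_poly_sum: "(\<And>i. i \<in> I \<Longrightarrow> trig_poly (F i)) \<Longrightarrow> trig_poly (\<lambda>\<theta>. \<Sum>i\<in>I. F i \<theta>)"
  by (induction I rule: infinite_finite_induct) (auto intro: trig_poly.zero trig_poly_sum_two)

lemma trig_poly_prod: "(\<And>i. i \<in> I \<Longrightarrow> trig_poly (F i)) \<Longrightarrow> trig_poly (\<lambda>\<theta>. \<Prod>i\<in>I. F i \<theta>)"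
  by (induction I rule: infinite_finite_induct) (auto intro: trig_poly_const trig_poly_mult)

lemma trig_poly_power: "trig_poly F \<Longrightarrow> trig_poly (\<lambda>\<theta>. F \<theta> ^ n)"
  by (induction n) (auto intro: trig_poly_const trig_poly_mult)

lemma trig_poly_difference_symbol: "trig_poly (difference_symbol l L a)"
proof -
  have "trig_poly (\<lambda>\<theta>. exp (\<i> * of_real (\<theta> $ k)) - 1)" "trig_poly (\<lambda>\<theta>. exp (- \<i> * of_real (\<theta> $ k)) - 1)" for k :: 'a
    using trig_poly_sum_two[OF trig_poly_osc[of 1 "axis k 1"] trig_poly_const[of "-1"]]
      trig_poly_sum_two[OF trig_poly_osc[of 1 "- axis k 1"] trig_poly_const[of "-1"]]
    by (simp_all add: inner_axis')
  thus ?thesis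
    unfolding difference_symbol_def[abs_def]
    by (intro trig_poly_sum trig_poly_mult trig_poly_prod trig_poly_power trig_poly_const)
qed

text \<open>The expansion is along rays, so the coefficients may depend on the direction \<theta>,
  but C does not. The bound is global because the exponents are purely imaginary.\<close>

lemma trig_poly_Taylor:
  assumes "trig_poly (F :: real ^ 'd::finite \<Rightarrow> complex)"
  shows "\<exists>q C. C \<ge> 0 \<and> (\<forall>s \<theta>. norm (F (s *\<^sub>R \<theta>) - (\<Sum>n\<le>N. q n \<theta> * of_real s ^ n)) \<le> C * norm (s *\<^sub>R \<theta>) ^ Suc N)"
  using assms
proof induction
  case zero
  show ?case by (intro exI[of _ "\<lambda>_ _. 0"] exI[of _ 0]) simp
next
  case (add F c m)
  then obtain q C where C: "C \<ge> 0" and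
    qC: "\<And>s \<theta>. norm (F (s *\<^sub>R \<theta>) - (\<Sum>n\<le>N. q n \<theta> * of_real s ^ n)) \<le> C * norm (s *\<^sub>R \<theta>) ^ Suc N"
    by blast
  define q' where "q' n \<theta> = c * ((\<i> * of_real (m \<bullet> \<theta>)) ^ n / fact n) + q n \<theta>" for n \<theta>
  define C' where "C' = norm c * norm m ^ Suc N + C"
  have "norm (c * osc m (s *\<^sub>R \<theta>) + F (s *\<^sub>R \<theta>) - (\<Sum>n\<le>N. q' n \<theta> * of_real s ^ n)) \<le> C' * norm (s *\<^sub>R \<theta>) ^ Suc N"
    for s \<theta>
  proof -
    let ?z = "\<i> * of_real (m \<bullet> (s *\<^sub>R \<theta>)) :: complex"
    have sum: "(\<Sum>n\<le>N. q' n \<theta> * of_real s ^ n) = c * (\<Sum>n\<le>N. ?z ^ n / fact n) + (\<Sum>n\<le>N. q n \<theta> * of_real s ^ n)"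
      unfolding q'_def distrib_right sum.distrib sum_distrib_left
      by (intro arg_cong2[where f = "(+)"] sum.cong refl) (simp add: power_mult_distrib mult_ac)
    \<comment> \<open>Here \<open>Re ?z = 0\<close>, so the exponential factor of the remainder is
      1.\<close>
    have "norm (exp ?z - (\<Sum>n\<le>N. ?z ^ n / fact n)) \<le> exp \<bar>Re ?z\<bar> * norm ?z ^ Suc N / fact N"
      by (rule Taylor_exp)
    also have "\<dots> = \<bar>m \<bullet> (s *\<^sub>R \<theta>)\<bar> ^ Suc N / fact N"
      by (simp add: norm_mult abs_mult)
    also have "\<dots> \<le> \<bar>m \<bullet> (s *\<^sub>R \<theta>)\<bar> ^ Suc N / 1"
      by (intro divide_left_mono) (auto simp: fact_ge_1)
    also have "\<dots> \<le> (norm m * norm (s *\<^sub>R \<theta>)) ^ Suc N"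
      unfolding div_by_1 by (intro power_mono Cauchy_Schwarz_ineq2) auto
    finally have exp: "norm (exp ?z - (\<Sum>n\<le>N. ?z ^ n / fact n)) \<le> norm m ^ Suc N * norm (s *\<^sub>R \<theta>) ^ Suc N"
      by (simp only: power_mult_distrib)
    have "c * osc m (s *\<^sub>R \<theta>) + F (s *\<^sub>R \<theta>) - (\<Sum>n\<le>N. q' n \<theta> * of_real s ^ n) =
        c * (exp ?z - (\<Sum>n\<le>N. ?z ^ n / fact n)) + (F (s *\<^sub>R \<theta>) - (\<Sum>n\<le>N. q n \<theta> * of_real s ^ n))"
      unfolding sum by (simp only: algebra_simps)
    also have "norm \<dots> \<le> norm (c * (exp ?z - (\<Sum>n\<le>N. ?z ^ n / fact n))) + norm (F (s *\<^sub>R \<theta>) - (\<Sum>n\<le>N. q n \<theta> * of_real s ^ n))"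
      by (rule norm_triangle_ineq)
    also have "\<dots> \<le> norm c * (norm m ^ Suc N * norm (s *\<^sub>R \<theta>) ^ Suc N) + C * norm (s *\<^sub>R \<theta>) ^ Suc N"
      unfolding norm_mult[of c] by (intro add_mono mult_left_mono exp qC norm_ge_zero)
    finally show ?thesis by (simp only: C'_def algebra_simps)
  qed
  moreover have "C' \<ge> 0" using C by (simp add: C'_def)
  ultimately show ?case by blast
qed

text \<open>Letting s tend to 0 from the right kills the constant coefficient; dividing by s lowers
  the degree and the order by one.\<close>

lemma polynomial_vanishing_to_high_order:
  fixes c :: "nat \<Rightarrow> complex"
  assumes "\<And>s. 0 < s \<Longrightarrow> s \<le> 1 \<Longrightarrow> norm (\<Sum>n<N. c n * of_real s ^ n) \<le> C * s ^ N"
  shows "n < N \<Longrightarrow> c n = 0"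
  using assms
proof (induction N arbitrary: c n)
  case (Suc N)
  have c0: "c 0 = 0"
  proof -
    have "((\<lambda>s. C * s ^ Suc N) \<longlongrightarrow> C * 0 ^ Suc N) (at_right 0)"
      by (intro tendsto_intros)
    moreover have "((\<lambda>s. norm (\<Sum>n<Suc N. c n * of_real s ^ n)) \<longlongrightarrow> norm (\<Sum>n<Suc N. c n * of_real 0 ^ n)) (at_right 0)"
      by (intro tendsto_intros)
    moreover have "\<forall>\<^sub>F s in at_right 0. norm (\<Sum>n<Suc N. c n * of_real s ^ n) \<le> C * s ^ Suc N"
      unfolding eventually_at_right_field using Suc.prems(2) by (intro exI[of _ 1]) auto
    ultimately have "norm (\<Sum>n<Suc N. c n * of_real 0 ^ n) \<le> C * 0 ^ Suc N"
      by (intro tendsto_le[where F = "at_right (0 :: real)"]) auto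
    thus ?thesis by (simp add: sum.lessThan_Suc_shift)
  qed
  have shifted: "c (Suc n) = 0" if "n < N" for n
  proof (rule Suc.IH[OF that])
    fix s :: real assume s: "0 < s" "s \<le> 1"
    have "(\<Sum>n<Suc N. c n * of_real s ^ n) = of_real s * (\<Sum>n<N. c (Suc n) * of_real s ^ n)"
      by (simp add: sum.lessThan_Suc_shift c0 sum_distrib_left mult_ac del: sum.lessThan_Suc)
    with Suc.prems(2)[OF s] s show "norm (\<Sum>n<N. c (Suc n) * of_real s ^ n) \<le> C * s ^ N"
      by (simp add: norm_mult mult_ac)
  qed
  show ?case using c0 shifted Suc.prems(1) by (cases n) auto
qed simp

lemma diff_symbol_scaleR: "diff_symbol l b (s *\<^sub>R \<xi>) = of_real s ^ l * diff_symbol l b \<xi>"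
proof -
  have "(\<Prod>k\<in>UNIV. complex_of_real ((s *\<^sub>R \<xi>) $ k) ^ \<alpha> k) = of_real s ^ l * (\<Prod>k\<in>UNIV. complex_of_real (\<xi> $ k) ^ \<alpha> k)"
    if "mi_size \<alpha> = l" for \<alpha>
    unfolding that[symmetric] mi_size_def power_sum by (simp add: power_mult_distrib prod.distrib)
  thus ?thesis by (simp add: diff_symbol_def sum_distrib_left mult_ac)
qed

lemma symbol_consistency:
  fixes a :: "('d::{finite,linorder} + 'd \<Rightarrow> nat) \<Rightarrow> complex"
  assumes "approximates_to_order M l L a b"
  shows "\<exists>C>0. \<forall>\<epsilon>>0. norm (1 / of_real \<epsilon> ^ l * difference_symbol l L a (\<epsilon> *\<^sub>R \<xi>) - diff_symbol l b \<xi>) \<le> C * \<epsilon> ^ M"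
proof -
  obtain C where C: "C > 0" "\<And>\<epsilon> y. \<epsilon> > 0 \<Longrightarrow>
      norm (difference_op l L a \<epsilon> (\<lambda>y. osc y \<xi>) y - diff_op l b (\<lambda>y. osc y \<xi>) y) \<le> C * \<epsilon> ^ M"
    using assms bounded_smooth_osc unfolding approximates_to_order_def by metis
  \<comment> \<open>At y = 0 the exponential is 1, leaving the difference of the
    eigenvalues.\<close>
  from C(2)[of _ 0] show ?thesis
    by (intro exI[of _ C]) (simp add: C(1) difference_op_osc diff_op_osc)
qed

text \<open>
  The hypothesis tested on exponentials gives only a constant depending on \<open>\<theta>\<close>. That suffices to
  cancel the Taylor coefficients of \<open>s \<mapsto> A(s \<theta>) - s\<^sup>l \<A>(\<theta>)\<close> below order \<open>l + M\<close>, and the Taylor remainder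
  is uniform.
\<close>

lemma symbol_approximation:
  fixes a :: "('d::{finite,linorder} + 'd \<Rightarrow> nat) \<Rightarrow> complex"
  assumes approx: "approximates_to_order M l L a b" and M: "M \<ge> 1"
  shows "\<exists>C\<ge>0. \<forall>\<theta>. norm (difference_symbol l L a \<theta> - diff_symbol l b \<theta>) \<le> C * norm \<theta> ^ (l + M)"
proof -
  \<comment> \<open>The Taylor remainder then has order exactly l + M, and M \<ge> 1 puts the
    homogeneous term of degree l among the coefficients kept.\<close>
  define N where "N = l + M - 1"
  have N: "Suc N = l + M" "l \<le> N" using M by (auto simp: N_def)
  obtain q C where C: "C \<ge> 0" and q: "\<And>s \<theta>. norm (difference_symbol l L a (s *\<^sub>R \<theta>) - (\<Sum>n\<le>N. q n \<theta> * of_real s ^ n))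
      \<le> C * norm (s *\<^sub>R \<theta>) ^ Suc N"
    using trig_poly_Taylor[where N = N and F = "difference_symbol l L a", OF trig_poly_difference_symbol] by blast
  have "norm (difference_symbol l L a \<theta> - diff_symbol l b \<theta>) \<le> C * norm \<theta> ^ (l + M)" for \<theta>
  proof -
    obtain D where D: "D > 0" "\<And>s. s > 0 \<Longrightarrow>
        norm (1 / of_real s ^ l * difference_symbol l L a (s *\<^sub>R \<theta>) - diff_symbol l b \<theta>) \<le> D * s ^ M"
      using symbol_consistency[OF approx] by metis
    define c where "c n = q n \<theta> - (if n = l then diff_symbol l b \<theta> else 0)" for n
    have sum_c: "(\<Sum>n<Suc N. c n * of_real s ^ n) = (\<Sum>n\<le>N. q n \<theta> * of_real s ^ n) - diff_symbol l b \<theta> * of_real s ^ l" for s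
      using N(2) by (simp add: c_def left_diff_distrib sum_subtractf if_distrib[of "\<lambda>x. x * _"]
          lessThan_Suc_atMost del: sum.lessThan_Suc cong: if_cong)
    have "norm (\<Sum>n<Suc N. c n * of_real s ^ n) \<le> (C * norm \<theta> ^ Suc N + D) * s ^ Suc N" if "0 < s" for s
    proof -
      have "difference_symbol l L a (s *\<^sub>R \<theta>) - diff_symbol l b \<theta> * of_real s ^ l =
          of_real s ^ l * (1 / of_real s ^ l * difference_symbol l L a (s *\<^sub>R \<theta>) - diff_symbol l b \<theta>)"
        using that by (simp add: field_simps)
      hence "norm (difference_symbol l L a (s *\<^sub>R \<theta>) - diff_symbol l b \<theta> * of_real s ^ l) \<le> s ^ l * (D * s ^ M)"
        using D(2)[OF that] that by (simp add: norm_mult norm_power)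
      also have "\<dots> = D * s ^ Suc N" by (simp only: N(1) power_add mult_ac)
      finally have "norm (difference_symbol l L a (s *\<^sub>R \<theta>) - diff_symbol l b \<theta> * of_real s ^ l) \<le> D * s ^ Suc N" .
      moreover have "norm (difference_symbol l L a (s *\<^sub>R \<theta>) - (\<Sum>n\<le>N. q n \<theta> * of_real s ^ n)) \<le> C * norm \<theta> ^ Suc N * s ^ Suc N"
        using q[of s \<theta>] that by (simp only: norm_scaleR power_mult_distrib mult_ac abs_of_pos)
      ultimately show ?thesis
        using norm_triangle_ineq4[of "difference_symbol l L a (s *\<^sub>R \<theta>) - diff_symbol l b \<theta> * of_real s ^ l"
            "difference_symbol l L a (s *\<^sub>R \<theta>) - (\<Sum>n\<le>N. q n \<theta> * of_real s ^ n)"]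
        unfolding sum_c distrib_right by simp
    qed
    hence "c n = 0" if "n < Suc N" for n
      by (intro polynomial_vanishing_to_high_order[OF _ that]) auto
    \<comment> \<open>At s = 1 the vanishing coefficients identify the Taylor polynomial with the
      differential symbol, so the remainder estimate at s = 1 is the claim.\<close>
    hence "(\<Sum>n<Suc N. c n * of_real 1 ^ n) = 0" by (intro sum.neutral) auto
    hence "(\<Sum>n\<le>N. q n \<theta> * of_real 1 ^ n) = diff_symbol l b \<theta>" unfolding sum_c by simp
    with q[of 1 \<theta>] show ?thesis by (simp add: N(1))
  qed
  with C show ?thesis by blast
qed

section \<open>Coercivity of the difference symbol\<close>

lemma coercive_near_zero_and_positive:
  fixes f :: "'a::euclidean_space \<Rightarrow> real"
  assumes K: "compact K" and cont: "continuous_on K f"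
    and pos: "\<And>x. x \<in> K \<Longrightarrow> x \<noteq> 0 \<Longrightarrow> f x > 0"
    and near: "c > 0" "r > 0" "\<And>x. norm x < r \<Longrightarrow> f x \<ge> c * norm x ^ l"
  shows "\<exists>c'>0. \<forall>x\<in>K. f x \<ge> c' * norm x ^ l"
proof -
  obtain R where R: "R > 0" "\<And>x. x \<in> K \<Longrightarrow> norm x \<le> R"
    using compact_imp_bounded[OF K] bounded_pos by blast
  obtain m where m: "m > 0" "\<And>x. x \<in> K - ball 0 r \<Longrightarrow> m \<le> f x"
  proof (cases "K - ball 0 r = {}")
    case True
    show ?thesis by (rule that[of 1]) (use True in auto)
  next
    case False
    have "compact (K - ball 0 r)" using K by (rule compact_diff) auto
    from continuous_attains_inf[OF this False continuous_on_subset[OF cont]]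
    obtain z where z: "z \<in> K - ball 0 r" "\<And>x. x \<in> K - ball 0 r \<Longrightarrow> f z \<le> f x" by auto
    have "f z > 0" using z(1) near(2) by (intro pos) auto
    thus ?thesis using that z(2) by blast
  qed
  \<comment> \<open>Outside the ball f is at least m, while |x|^l is at most R^l on K; hence the
    ratio \<open>m / R ^ l\<close>.\<close>
  define c' where "c' = min c (m / R ^ l)"
  have "c' * norm x ^ l \<le> f x" if x: "x \<in> K" for x
  proof (cases "norm x < r")
    case True
    have "c' * norm x ^ l \<le> c * norm x ^ l" by (intro mult_right_mono) (auto simp: c'_def)
    with near(3)[OF True] show ?thesis by linarith
  next
    case False
    have "c' * norm x ^ l \<le> (m / R ^ l) * R ^ l"
      using m(1) R x by (intro mult_mono power_mono) (auto simp: c'_def)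
    also have "\<dots> = m" using R by simp
    also have "m \<le> f x" using m(2) x False by auto
    finally show ?thesis .
  qed
  moreover have "c' > 0" using near(1) m(1) R(1) by (simp add: c'_def)
  ultimately show ?thesis by blast
qed

lemma difference_symbol_coercive:
  fixes a :: "('d::{finite,linorder} + 'd \<Rightarrow> nat) \<Rightarrow> complex"
  assumes approx: "approximates_to_order M l L a b" and M: "M \<ge> 1"
    and elliptic: "strongly_elliptic l b"
    and pos: "\<And>\<theta>. \<theta> \<in> cube pi - {0} \<Longrightarrow> Re (difference_symbol l L a \<theta>) > 0"
  shows "\<exists>c>0. \<forall>\<theta>\<in>cube pi. Re (difference_symbol l L a \<theta>) \<ge> c * norm \<theta> ^ l"
proof -
  obtain C where C: "C \<ge> 0" "\<And>\<theta>. norm (difference_symbol l L a \<theta> - diff_symbol l b \<theta>) \<le> C * norm \<theta> ^ (l + M)"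
    using symbol_approximation[OF approx M] by metis
  obtain c where c: "c > 0" "\<And>\<xi>. Re (diff_symbol l b \<xi>) \<ge> c * norm \<xi> ^ l"
    using elliptic unfolding strongly_elliptic_def by metis
  \<comment> \<open>Below r the symbol error C |\<theta>|^(l + M) uses up at most half of the
    elliptic lower bound; r \<le> 1 serves to bound |\<theta>|^M by |\<theta>|, and C + 1 avoids
    division by 0.\<close>
  define r where "r = min 1 (c / (2 * (C + 1)))"
  have r: "r > 0" "r \<le> 1" "C * r \<le> c / 2"
  proof -
    show "r > 0" "r \<le> 1" using C(1) c(1) by (auto simp: r_def)
    have "C * r \<le> (C + 1) * (c / (2 * (C + 1)))"
      using C(1) c(1) by (intro mult_mono) (auto simp: r_def)
    also have "\<dots> = c / 2" using C(1) by (simp add: field_simps add_nonneg_pos)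
    finally show "C * r \<le> c / 2" .
  qed
  show ?thesis
  proof (rule coercive_near_zero_and_positive[where c = "c / 2" and r = r])
    show "c / 2 * norm \<theta> ^ l \<le> Re (difference_symbol l L a \<theta>)" if "norm \<theta> < r" for \<theta>
    proof -
      have "norm \<theta> ^ M \<le> norm \<theta> ^ 1" using that r M by (intro power_decreasing) auto
      hence "C * norm \<theta> ^ M \<le> C * r" using that C(1) by (intro mult_left_mono) auto
      hence "C * norm \<theta> ^ M * norm \<theta> ^ l \<le> c / 2 * norm \<theta> ^ l"
        using r(3) by (intro mult_right_mono) auto
      moreover have "Re (diff_symbol l b \<theta>) - Re (difference_symbol l L a \<theta>) \<le> C * norm \<theta> ^ M * norm \<theta> ^ l"
        using C(2)[of \<theta>] abs_Re_le_cmod[of "difference_symbol l L a \<theta> - diff_symbol l b \<theta>"]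
        by (simp add: power_add mult_ac)
      ultimately show ?thesis using c(2)[of \<theta>] by linarith
    qed
    show "continuous_on (cube pi) (\<lambda>\<theta>. Re (difference_symbol l L a \<theta>))"
      by (intro continuous_intros continuous_difference_symbol)
  qed (use c r pos in auto)
qed

section \<open>Scaling and the error estimate\<close>

lemma lborel_integral_scaleR:
  fixes f :: "'a::euclidean_space \<Rightarrow> complex"
  assumes "c > 0" and f [measurable]: "f \<in> borel_measurable borel"
  shows "(LINT x|lborel. f x) = of_real c ^ DIM('a) * (LINT x|lborel. f (c *\<^sub>R x))"
proof -
  have "(LINT x|lborel. f x) =
      (LINT x|density (distr lborel borel (\<lambda>x. 0 + c *\<^sub>R x)) (\<lambda>_. ennreal (\<bar>c\<bar> ^ DIM('a))). f x)"
    using assms(1) by (subst lborel_affine[of c 0]) auto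
  also have "\<dots> = (LINT x|distr lborel borel (\<lambda>x. 0 + c *\<^sub>R x). \<bar>c\<bar> ^ DIM('a) *\<^sub>R f x)"
    by (subst integral_density) auto
  also have "\<dots> = (LINT x|lborel. \<bar>c\<bar> ^ DIM('a) *\<^sub>R f (c *\<^sub>R x))"
    by (subst integral_distr) auto
  finally show ?thesis using assms(1) by (simp add: scaleR_conv_of_real)
qed

lemma green_integral_scaling:
  fixes a :: "('d::finite + 'd \<Rightarrow> nat) \<Rightarrow> complex"
  assumes \<tau>: "\<tau> > 0"
  shows "green_integral l L a \<epsilon> x (\<tau> ^ l) =
         1 / of_real \<tau> ^ CARD('d) * green_integral l L a (\<epsilon> / \<tau>) (x /\<^sub>R \<tau>) 1"
proof -
  let ?f = "\<lambda>\<eta>. green_density l L a \<epsilon> (\<tau> ^ l) \<eta> * osc x \<eta>"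
  have "(\<lambda>\<eta>. green_density l L a \<epsilon> (\<tau> ^ l) \<eta> * osc x \<eta>) \<in> borel_measurable borel"
    using borel_measurable_integrable[OF integrable_osc[OF _ integrable_green_density]] by simp
  hence "superpos lborel (green_density l L a \<epsilon> (\<tau> ^ l)) x = of_real (1 / \<tau>) ^ CARD('d) * (LINT \<xi>|lborel. ?f ((1 / \<tau>) *\<^sub>R \<xi>))"
    unfolding superpos_def using \<tau> by (subst lborel_integral_scaleR[of "1 / \<tau>"]) auto
  also have "(\<lambda>\<xi>. ?f ((1 / \<tau>) *\<^sub>R \<xi>)) = (\<lambda>\<xi>. green_density l L a (\<epsilon> / \<tau>) 1 \<xi> * osc (x /\<^sub>R \<tau>) \<xi>)"
  proof
    fix \<xi> :: "real ^ 'd"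
    have "(1 / \<tau>) *\<^sub>R \<xi> \<in> cube (pi / \<epsilon>) \<longleftrightarrow> \<xi> \<in> cube (pi / (\<epsilon> / \<tau>))"
      using \<tau> by (simp add: mem_box_cart field_simps)
    moreover have "\<tau> ^ l / \<epsilon> ^ l = 1 / (\<epsilon> / \<tau>) ^ l" by (simp add: power_divide)
    moreover have "\<epsilon> *\<^sub>R (1 / \<tau>) *\<^sub>R \<xi> = (\<epsilon> / \<tau>) *\<^sub>R \<xi>" by simp
    moreover have "x \<bullet> ((1 / \<tau>) *\<^sub>R \<xi>) = (x /\<^sub>R \<tau>) \<bullet> \<xi>" by (simp add: divide_inverse)
    ultimately show "?f ((1 / \<tau>) *\<^sub>R \<xi>) = green_density l L a (\<epsilon> / \<tau>) 1 \<xi> * osc (x /\<^sub>R \<tau>) \<xi>"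
      by (simp only: green_density_def indicator_def)
  qed
  finally show ?thesis
    by (simp add: green_integral_def superpos_def power_one_over)
qed

text \<open>Mean value inequality on a half-plane, which is convex and where the modulus of exp is
  at most \<open>exp (- r)\<close>. This is why both symbols need the lower bound.\<close>

lemma norm_exp_minus_diff_le:
  fixes z w :: complex
  assumes "r \<le> Re z" "r \<le> Re w"
  shows "norm (exp (- z) - exp (- w)) \<le> exp (- r) * norm (z - w)"
proof -
  have "norm (exp (- z) - exp (- w)) \<le> exp (- r) * norm (- z - - w)"
  proof (rule field_differentiable_bound[where S = "{z. Re z \<le> - r}" and f = exp and f' = exp])
    show "convex {z. Re z \<le> - r}" by (rule convex_halfspace_Re_le)
  qed (use assms in \<open>auto intro: DERIV_subset[OF DERIV_exp] simp: norm_exp_eq_Re\<close>)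
  thus ?thesis by (simp add: norm_minus_commute)
qed

lemma power_le_exp:
  fixes x :: real
  assumes "x \<ge> 0"
  shows "x ^ n \<le> fact n * exp x"
proof -
  have "(\<Sum>k\<in>{n}. inverse (fact k) *\<^sub>R x ^ k) \<le> exp x"
    unfolding exp_def by (rule sum_le_suminf[OF summable_exp_generic]) (use assms in auto)
  thus ?thesis by (simp add: field_simps)
qed

text \<open>Comparison with the product of the integrable functions 1 / (1 + s^2), which avoids
  polar coordinates.\<close>

lemma integrable_power_exp_minus_norm:
  fixes c :: real
  assumes c: "c > 0" and l: "l \<ge> 1"
  shows "integrable lborel (\<lambda>\<xi> :: real ^ 'd::finite. (1 + norm \<xi>) ^ n * exp (- c * norm \<xi> ^ l))"
proof -
  let ?N = "n + 2 * CARD('d)"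
  \<comment> \<open>The product of the factors 1 + \<xi>_k^2 is at most (1 + |\<xi>|)^(2 d), hence
    the exponent \<open>?N\<close>. Replacing |\<xi>|^l by |\<xi>| costs \<open>exp (2 * c)\<close>,
    and x^N \<le> N! exp x at x = c (1 + |\<xi>|) gives the remaining factor.\<close>
  define K where "K = fact ?N / c ^ ?N * exp (2 * c)"
  have inv: "integrable lborel (\<lambda>s :: real. inverse (1 + s\<^sup>2))"
    using integrable_inverse_1_plus_square by (simp add: set_integrable_def)
  have int: "integrable lborel (\<lambda>\<xi> :: real ^ 'd. K * (\<Prod>k\<in>UNIV. inverse (1 + (\<xi> $ k)\<^sup>2)))"
    by (intro Bochner_Integration.integrable_mult_right lborel_integral_prod_cart(1) inv)
  have "(1 + norm \<xi>) ^ n * exp (- c * norm \<xi> ^ l) \<le> K * (\<Prod>k\<in>UNIV. inverse (1 + (\<xi> $ k)\<^sup>2))" for \<xi> :: "real ^ 'd"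
  proof -
    let ?r = "norm \<xi>"
    have pos: "(\<Prod>k\<in>UNIV. 1 + (\<xi> $ k)\<^sup>2) > 0"
      by (intro prod_pos) (auto intro: add_pos_nonneg)
    have "(\<Prod>k\<in>(UNIV :: 'd set). 1 + (\<xi> $ k)\<^sup>2) \<le> (\<Prod>k\<in>(UNIV :: 'd set). (1 + ?r)\<^sup>2)"
    proof (intro prod_mono conjI)
      fix k
      have "\<bar>\<xi> $ k\<bar>\<^sup>2 \<le> ?r\<^sup>2" by (intro power_mono component_le_norm_cart) auto
      thus "1 + (\<xi> $ k)\<^sup>2 \<le> (1 + ?r)\<^sup>2" by (simp add: power2_sum add_increasing2)
    qed (simp add: add_nonneg_nonneg)
    hence prod: "(\<Prod>k\<in>UNIV. 1 + (\<xi> $ k)\<^sup>2) \<le> (1 + ?r) ^ (2 * CARD('d))"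
      by (simp add: power_mult)
    have "?r \<le> 1 + ?r ^ l"
    proof (cases "?r \<le> 1")
      case True
      thus ?thesis by (simp add: add_increasing2)
    next
      case False
      hence "?r ^ 1 \<le> ?r ^ l" using l by (intro power_increasing) auto
      thus ?thesis by simp
    qed
    hence "c * (1 + ?r) \<le> c * (2 + ?r ^ l)"
      using c by (intro mult_left_mono) auto
    hence exp: "exp (- c * ?r ^ l) \<le> exp (2 * c) * exp (- (c * (1 + ?r)))"
      by (simp add: algebra_simps flip: exp_add)
    have "(1 + ?r) ^ n * exp (- c * ?r ^ l) * (\<Prod>k\<in>UNIV. 1 + (\<xi> $ k)\<^sup>2) \<le>
        (1 + ?r) ^ n * (exp (2 * c) * exp (- (c * (1 + ?r)))) * (1 + ?r) ^ (2 * CARD('d))"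
      using pos by (intro mult_mono exp prod) (auto intro: less_imp_le)
    also have "\<dots> = exp (2 * c) * exp (- (c * (1 + ?r))) * ((c * (1 + ?r)) ^ ?N / c ^ ?N)"
      using c by (simp add: power_add power_mult_distrib)
    also have "\<dots> \<le> exp (2 * c) * exp (- (c * (1 + ?r))) * (fact ?N * exp (c * (1 + ?r)) / c ^ ?N)"
      using c by (intro mult_left_mono divide_right_mono power_le_exp) auto
    also have "\<dots> = K" by (simp add: K_def exp_minus)
    finally have "(1 + ?r) ^ n * exp (- c * ?r ^ l) \<le> K * inverse (\<Prod>k\<in>UNIV. 1 + (\<xi> $ k)\<^sup>2)"
      using pos by (simp add: field_simps)
    thus ?thesis using prod_inversef[of "\<lambda>k. 1 + (\<xi> $ k)\<^sup>2" UNIV] by (simp add: comp_def)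
  qed
  moreover have "(\<lambda>\<xi> :: real ^ 'd. (1 + norm \<xi>) ^ n * exp (- c * norm \<xi> ^ l)) \<in> borel_measurable borel"
    by (intro borel_measurable_continuous_onI continuous_intros)
  ultimately show ?thesis
    by (intro Bochner_Integration.integrable_bound[OF int] AE_I2) (auto intro: order_trans[OF _ abs_ge_self])
qed

text \<open>The factor C + 1 serves both cases: C is the symbol error inside the cube, and 1 pays
  for the tail of the heat density outside, where the discrete density vanishes.\<close>

lemma green_density_approximation:
  fixes a :: "('d::{finite,linorder} + 'd \<Rightarrow> nat) \<Rightarrow> complex"
  assumes A: "\<And>\<theta>. norm (difference_symbol l L a \<theta> - diff_symbol l b \<theta>) \<le> C * norm \<theta> ^ (l + M)"
    and coercive: "\<And>\<theta>. \<theta> \<in> cube pi \<Longrightarrow> c * norm \<theta> ^ l \<le> Re (difference_symbol l L a \<theta>)"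
    and elliptic: "\<And>\<xi>. c * norm \<xi> ^ l \<le> Re (diff_symbol l b \<xi>)"
    and C: "C \<ge> 0" and s: "s > 0"
  shows "norm (green_density l L a s 1 \<xi> - exp (- diff_symbol l b \<xi>))
           \<le> s ^ M * ((C + 1) * ((1 + norm \<xi>) ^ (l + M) * exp (- c * norm \<xi> ^ l)))"
proof (cases "\<xi> \<in> cube (pi / s)")
  case True
  define z where "z = difference_symbol l L a (s *\<^sub>R \<xi>) / of_real s ^ l"
  have "s *\<^sub>R \<xi> \<in> cube pi" using True s by (simp add: mem_box_cart field_simps)
  from coercive[OF this] have Re_z: "c * norm \<xi> ^ l \<le> Re z"
    using s by (simp add: z_def power_mult_distrib field_simps flip: of_real_power)
  have "z - diff_symbol l b \<xi> = (difference_symbol l L a (s *\<^sub>R \<xi>) - diff_symbol l b (s *\<^sub>R \<xi>)) / of_real s ^ l"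
    using s by (simp add: z_def diff_symbol_scaleR diff_divide_distrib)
  also have "norm \<dots> \<le> C * norm (s *\<^sub>R \<xi>) ^ (l + M) / s ^ l"
    using s A by (simp add: norm_divide norm_power divide_right_mono del: norm_scaleR)
  also have "\<dots> = C * s ^ M * norm \<xi> ^ (l + M)"
    using s by (simp add: power_mult_distrib power_add)
  finally have diff: "norm (z - diff_symbol l b \<xi>) \<le> C * s ^ M * norm \<xi> ^ (l + M)" .
  have "norm (exp (- z) - exp (- diff_symbol l b \<xi>)) \<le> exp (- (c * norm \<xi> ^ l)) * norm (z - diff_symbol l b \<xi>)"
    by (rule norm_exp_minus_diff_le[OF Re_z elliptic])
  also have "\<dots> \<le> exp (- (c * norm \<xi> ^ l)) * ((C + 1) * s ^ M * (1 + norm \<xi>) ^ (l + M))"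
    using C s by (intro mult_left_mono order_trans[OF diff] mult_mono power_mono) auto
  finally have "norm (exp (- z) - exp (- diff_symbol l b \<xi>)) \<le>
      s ^ M * ((C + 1) * ((1 + norm \<xi>) ^ (l + M) * exp (- c * norm \<xi> ^ l)))"
    by (simp add: mult_ac)
  moreover have "green_density l L a s 1 \<xi> = exp (- z)"
    using True by (simp add: green_density_def z_def)
  ultimately show ?thesis by (simp only:)
next
  case False
  have "\<not> (\<forall>k. \<bar>\<xi> $ k\<bar> \<le> pi / s)"
  proof
    assume "\<forall>k. \<bar>\<xi> $ k\<bar> \<le> pi / s"
    hence "- (pi / s) \<le> \<xi> $ k \<and> \<xi> $ k \<le> pi / s" for k using abs_le_D1 abs_le_D2 by (metis minus_le_iff)
    with False show False by (simp add: mem_box_cart)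
  qed
  then obtain k where "\<bar>\<xi> $ k\<bar> > pi / s" by (auto simp: not_le)
  with component_le_norm_cart[of \<xi> k] have "pi / s < norm \<xi>" by linarith
  hence "pi < s * norm \<xi>" using s by (simp add: field_simps)
  hence "1 \<le> s * norm \<xi>" using pi_gt3 by linarith
  hence "1 \<le> (s * norm \<xi>) ^ M" by (rule one_le_power)
  also have "\<dots> = s ^ M * norm \<xi> ^ M" by (rule power_mult_distrib)
  also have "\<dots> \<le> s ^ M * ((C + 1) * (1 + norm \<xi>) ^ (l + M))"
  proof (intro mult_left_mono)
    have "norm \<xi> ^ M \<le> (1 + norm \<xi>) ^ M" by (intro power_mono) auto
    also have "\<dots> \<le> (1 + norm \<xi>) ^ (l + M)" by (intro power_increasing) auto
    also have "\<dots> \<le> (C + 1) * (1 + norm \<xi>) ^ (l + M)" using C by (simp add: distrib_right)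
    finally show "norm \<xi> ^ M \<le> (C + 1) * (1 + norm \<xi>) ^ (l + M)" .
  qed (use s in auto)
  finally have one: "1 \<le> s ^ M * ((C + 1) * (1 + norm \<xi>) ^ (l + M))" .
  have "norm (green_density l L a s 1 \<xi> - exp (- diff_symbol l b \<xi>)) = exp (- Re (diff_symbol l b \<xi>))"
    using False by (simp add: green_density_def norm_exp_eq_Re)
  also have "\<dots> \<le> 1 * exp (- c * norm \<xi> ^ l)" using elliptic by simp
  also have "\<dots> \<le> s ^ M * ((C + 1) * (1 + norm \<xi>) ^ (l + M)) * exp (- c * norm \<xi> ^ l)"
    by (intro mult_right_mono one) auto
  finally show ?thesis by (simp add: mult_ac)
qed

lemma heat_profile_eq_superpos:
  "heat_profile l b y = 1 / (2 * of_real pi) ^ CARD('d) *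
     superpos lborel (\<lambda>\<xi> :: real ^ 'd::finite. exp (- diff_symbol l b \<xi>)) y"
  by (simp add: heat_profile_def superpos_def)

lemma continuous_diff_symbol: "continuous_on S (diff_symbol l b)"
  unfolding diff_symbol_def by (intro continuous_intros)

text \<open>The majorant h is independent of s and y. It dominates the heat density as well, which
  makes the integral of the difference split.\<close>

lemma green_integral_approximation:
  fixes a :: "('d::{finite,linorder} + 'd \<Rightarrow> nat) \<Rightarrow> complex"
  assumes l: "l \<ge> 1" and M: "M \<ge> 1"
    and elliptic: "strongly_elliptic l b"
    and approx: "approximates_to_order M l L a b"
    and pos: "\<And>\<theta>. \<theta> \<in> cube pi - {0} \<Longrightarrow> Re (difference_symbol l L a \<theta>) > 0"
  shows "\<exists>C\<ge>0. \<forall>s>0. \<forall>y. norm (green_integral l L a s y 1 - heat_profile l b y) \<le> C * s ^ M"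
proof -
  obtain C where C: "C \<ge> 0" "\<And>\<theta>. norm (difference_symbol l L a \<theta> - diff_symbol l b \<theta>) \<le> C * norm \<theta> ^ (l + M)"
    using symbol_approximation[OF approx M] by metis
  obtain c1 where c1: "c1 > 0" "\<And>\<xi>. Re (diff_symbol l b \<xi>) \<ge> c1 * norm \<xi> ^ l"
    using elliptic unfolding strongly_elliptic_def by metis
  obtain c2 where c2: "c2 > 0" "\<And>\<theta>. \<theta> \<in> cube pi \<Longrightarrow> Re (difference_symbol l L a \<theta>) \<ge> c2 * norm \<theta> ^ l"
    using difference_symbol_coercive[OF approx M elliptic pos] by metis
  define c where "c = min c1 c2"
  have c: "c > 0" using c1(1) c2(1) by (simp add: c_def)
  have le: "c * norm \<xi> ^ l \<le> c1 * norm \<xi> ^ l" "c * norm \<xi> ^ l \<le> c2 * norm \<xi> ^ l" for \<xi> :: "(real, 'd) vec"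
    by (auto simp: c_def intro!: mult_right_mono)
  have ell: "c * norm \<xi> ^ l \<le> Re (diff_symbol l b \<xi>)" for \<xi>
    using le(1) c1(2) by (rule order_trans)
  have coer: "c * norm \<theta> ^ l \<le> Re (difference_symbol l L a \<theta>)" if "\<theta> \<in> cube pi" for \<theta>
    using le(2) c2(2)[OF that] by (rule order_trans)
  define h where "h \<xi> = (C + 1) * ((1 + norm \<xi>) ^ (l + M) * exp (- c * norm \<xi> ^ l))" for \<xi> :: "(real, 'd) vec"
  have h: "integrable lborel h"
    unfolding h_def by (intro Bochner_Integration.integrable_mult_right integrable_power_exp_minus_norm c l)
  have h0: "h \<xi> \<ge> 0" for \<xi> using C(1) by (simp add: h_def)
  have e: "integrable lborel (\<lambda>\<xi>. exp (- diff_symbol l b \<xi>))"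
  proof (rule Bochner_Integration.integrable_bound[OF h])
    show "(\<lambda>\<xi>. exp (- diff_symbol l b \<xi>)) \<in> borel_measurable lborel"
      unfolding measurable_lborel2
      by (intro borel_measurable_continuous_onI continuous_intros continuous_diff_symbol)
    show "AE \<xi> in lborel. norm (exp (- diff_symbol l b \<xi>)) \<le> norm (h \<xi>)"
    proof (intro AE_I2)
      fix \<xi>
      have "norm (exp (- diff_symbol l b \<xi>)) \<le> 1 * exp (- c * norm \<xi> ^ l)"
        using ell[of \<xi>] by (simp add: norm_exp_eq_Re)
      also have "\<dots> \<le> (C + 1) * (1 + norm \<xi>) ^ (l + M) * exp (- c * norm \<xi> ^ l)"
      proof (rule mult_right_mono)
        have "1 * 1 \<le> (C + 1) * (1 + norm \<xi>) ^ (l + M)"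
          using C(1) by (intro mult_mono one_le_power) auto
        thus "1 \<le> (C + 1) * (1 + norm \<xi>) ^ (l + M)" by simp
      qed simp
      also have "\<dots> = norm (h \<xi>)" using h0[of \<xi>] by (simp add: h_def mult_ac)
      finally show "norm (exp (- diff_symbol l b \<xi>)) \<le> norm (h \<xi>)" .
    qed
  qed
  define k where "k = norm (1 / (2 * of_real pi) ^ CARD('d) :: complex)"
  have "norm (green_integral l L a s y 1 - heat_profile l b y) \<le> k * (LINT \<xi>|lborel. h \<xi>) * s ^ M" if s: "s > 0" for s y
  proof -
    let ?g = "\<lambda>\<xi>. green_density l L a s 1 \<xi> * osc y \<xi> - exp (- diff_symbol l b \<xi>) * osc y \<xi>"
    have int: "integrable lborel ?g"
      by (intro Bochner_Integration.integrable_diff integrable_osc e integrable_green_density) auto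
    have norm_g: "norm (?g \<xi>) \<le> s ^ M * h \<xi>" for \<xi>
    proof -
      have "norm (?g \<xi>) = norm (green_density l L a s 1 \<xi> - exp (- diff_symbol l b \<xi>))"
        by (simp add: norm_mult flip: left_diff_distrib)
      also have "\<dots> \<le> s ^ M * h \<xi>"
        unfolding h_def by (rule green_density_approximation[OF C(2) coer ell C(1) s])
      finally show ?thesis .
    qed
    have "superpos lborel (green_density l L a s 1) y - superpos lborel (\<lambda>\<xi>. exp (- diff_symbol l b \<xi>)) y = (LINT \<xi>|lborel. ?g \<xi>)"
      unfolding superpos_def
      by (intro Bochner_Integration.integral_diff[symmetric] integrable_osc e integrable_green_density) auto
    hence eq: "norm (green_integral l L a s y 1 - heat_profile l b y) = k * norm (LINT \<xi>|lborel. ?g \<xi>)"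
      by (simp only: green_integral_def heat_profile_eq_superpos k_def norm_mult flip: right_diff_distrib)
    have "(LINT \<xi>|lborel. norm (?g \<xi>)) \<le> (LINT \<xi>|lborel. s ^ M * h \<xi>)"
      using int h norm_g by (intro integral_mono) auto
    hence "norm (LINT \<xi>|lborel. ?g \<xi>) \<le> (LINT \<xi>|lborel. s ^ M * h \<xi>)"
      by (rule order_trans[OF integral_norm_bound])
    hence "norm (LINT \<xi>|lborel. ?g \<xi>) \<le> s ^ M * (LINT \<xi>|lborel. h \<xi>)" by simp
    from mult_left_mono[OF this, of k] show ?thesis
      unfolding eq by (simp add: k_def mult_ac)
  qed
  moreover have "k * (LINT \<xi>|lborel. h \<xi>) \<ge> 0"
    unfolding k_def by (intro mult_nonneg_nonneg Bochner_Integration.integral_nonneg h0) auto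
  ultimately show ?thesis by blast
qed

text \<open>Used with n = l, d and M + d to turn all real exponents into natural powers of
  t^(1/l).\<close>

lemma powr_divide_eq_power:
  fixes t :: real
  assumes "t > 0"
  shows "t powr (real n / real l) = (t powr (1 / real l)) ^ n"
  using assms by (simp add: powr_powr flip: powr_realpow)

theorem corollary3p1:
  fixes l L M :: nat
    and b :: "('d::{finite,linorder} \<Rightarrow> nat) \<Rightarrow> complex"
    and a :: "('d + 'd \<Rightarrow> nat) \<Rightarrow> complex"
    and u :: "real \<Rightarrow> (real, 'd) vec \<Rightarrow> real \<Rightarrow> complex"
    and \<epsilon>\<^sub>0 :: real
  assumes "l \<ge> 1" "even l" "L \<ge> l" "M \<ge> 1"
    and "strongly_elliptic l b"
    and "approximates_to_order M l L a b"
    and "\<forall>\<theta> \<in> cbox (vec (- pi)) (vec pi) - {0}. Re (difference_symbol l L a \<theta>) > 0"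
    and "\<forall>\<epsilon>>0. discrete_green l L a \<epsilon> (u \<epsilon>)"
    and "\<epsilon>\<^sub>0 > 0"
  shows "\<exists>C>0. \<forall>\<^sub>F t in at_top.
    (SUP \<epsilon>\<in>{0<..\<epsilon>\<^sub>0}. SUP x\<in>grid \<epsilon>.
       ennreal (norm (u \<epsilon> x t
         - 1 / of_real (t powr (real CARD('d) / real l))
           * heat_profile l b (x /\<^sub>R t powr (1 / real l)))))
    \<le> ennreal (C * (1 / t powr (real (M + CARD('d)) / real l)))"
proof -
  let ?d = "CARD('d)"
  obtain C where C: "C \<ge> 0"
    "\<And>s y. s > 0 \<Longrightarrow> norm (green_integral l L a s y 1 - heat_profile l b y) \<le> C * s ^ M"
    using green_integral_approximation[of l M b L a] assms by blast
  have bound: "norm (u \<epsilon> x t - 1 / of_real (t powr (real ?d / real l)) * heat_profile l b (x /\<^sub>R t powr (1 / real l)))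
      \<le> (C * \<epsilon>\<^sub>0 ^ M + 1) * (1 / t powr (real (M + ?d) / real l))"
    if t: "t > 0" and \<epsilon>: "0 < \<epsilon>" "\<epsilon> \<le> \<epsilon>\<^sub>0" and x: "x \<in> grid \<epsilon>" for t \<epsilon> x
  proof -
    define \<tau> where "\<tau> = t powr (1 / real l)"
    have \<tau>: "\<tau> > 0" using t by (simp add: \<tau>_def)
    have t_eq: "t = \<tau> ^ l"
      using powr_divide_eq_power[OF t, of l l] assms(1) t by (simp add: \<tau>_def)
    have pow: "t powr (real n / real l) = \<tau> ^ n" for n
      using powr_divide_eq_power[OF t, of n l] by (simp add: \<tau>_def)
    have "u \<epsilon> x t = green_integral l L a \<epsilon> x t"
      using discrete_green_unique[OF \<epsilon>(1) _ x] assms(8) \<epsilon>(1) t by simp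
    also have "\<dots> = 1 / of_real \<tau> ^ ?d * green_integral l L a (\<epsilon> / \<tau>) (x /\<^sub>R \<tau>) 1"
      unfolding t_eq by (rule green_integral_scaling[OF \<tau>])
    finally have "norm (u \<epsilon> x t - 1 / of_real (\<tau> ^ ?d) * heat_profile l b (x /\<^sub>R \<tau>)) =
        norm (1 / of_real \<tau> ^ ?d * (green_integral l L a (\<epsilon> / \<tau>) (x /\<^sub>R \<tau>) 1 - heat_profile l b (x /\<^sub>R \<tau>)))"
      by (simp add: right_diff_distrib)
    also have "\<dots> \<le> 1 / \<tau> ^ ?d * (C * (\<epsilon> / \<tau>) ^ M)"
      using C(2)[of "\<epsilon> / \<tau>" "x /\<^sub>R \<tau>"] \<epsilon> \<tau>
      by (simp add: norm_mult norm_divide norm_power divide_right_mono)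
    also have "\<dots> \<le> 1 / \<tau> ^ ?d * (C * (\<epsilon>\<^sub>0 / \<tau>) ^ M)"
      using \<epsilon> \<tau> C(1) by (intro mult_left_mono power_mono divide_right_mono) auto
    also have "\<dots> = (C * \<epsilon>\<^sub>0 ^ M) * (1 / \<tau> ^ (M + ?d))"
      by (simp add: power_divide power_add)
    also have "\<dots> \<le> (C * \<epsilon>\<^sub>0 ^ M + 1) * (1 / \<tau> ^ (M + ?d))"
      using \<tau> by (intro mult_right_mono) auto
    finally show ?thesis unfolding pow \<tau>_def[symmetric] .
  qed
  \<comment> \<open>The pointwise bound holds for all t > 0, and suprema in \<open>ennreal\<close>
    are bounded by any pointwise bound. The summand 1 makes the constant positive even if C =
    0.\<close>
  have "\<forall>\<^sub>F t in at_top. (SUP \<epsilon>\<in>{0<..\<epsilon>\<^sub>0}. SUP x\<in>grid \<epsilon>.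
       ennreal (norm (u \<epsilon> x t
         - 1 / of_real (t powr (real CARD('d) / real l))
           * heat_profile l b (x /\<^sub>R t powr (1 / real l)))))
    \<le> ennreal ((C * \<epsilon>\<^sub>0 ^ M + 1) * (1 / t powr (real (M + CARD('d)) / real l)))"
    using eventually_gt_at_top[of 0]
    by eventually_elim (intro SUP_least ennreal_leI bound, auto)
  moreover have "C * \<epsilon>\<^sub>0 ^ M + 1 > 0" using C(1) assms(9) by (simp add: add_nonneg_pos)
  ultimately show ?thesis by blast
qed

end
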